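(* Let $v\ge 0$ be a real number. Then the following five identities hold. (1) $$\mathrm{m}\left(1+x+\frac{v}{2}(1-x)(y+z)\right)=\frac{2}{\pi}\int_{0}^{v}\frac{\tan^{-1}(u)}{u}\,du-\frac{4}{\pi^2}\mathrm{TS}(v,1).$$ (2) $$\mathrm{m}\left(x+\frac{v^2}{4}(1+x)^2+\left(y+\frac{v}{2}(1+x)\right)^2 z\right)=\frac{2}{\pi}\int_{0}^{v}\frac{\tan^{-1}(u)}{u}\,du-\frac{4}{\pi^2}\mathrm{TS}(v,1)+\frac{1}{2}\mathrm{m}\left(x+\frac{v^2}{4}(1+x)^2\right).$$ (3) $$\mathrm{m}\left((1+y)\left(1+\frac{v^2}{4}(x+x^{-1})^2\right)+\frac{v}{2}(1-y)(x+x^{-1})(z+z^{-1})\right)=\frac{4}{\pi}\int_{0}^{v}\frac{\tan^{-1}(u)}{u}\,du-\frac{8}{\pi^2}\mathrm{TS}(v,1).$$ (4) $$\mathrm{m}\left((z-z^{-1})+\frac{v}{2}(x+x^{-1})(y+y^{-1})\right)=\frac{2}{\pi}\int_{0}^{v}\frac{\tan^{-1}(u)}{u}\,du-\frac{4}{\pi^2}\mathrm{TS}(v,1).$$ (5) $$\mathrm{m}\left(\left(4(1+y)^2-(z+z^{-1})^2\right)\left(1+\frac{v^2}{4}(x+x^{-1})^2\right)^2+(z-z^{-1})^2(1+y)^2\left(1-\frac{v^2}{4}(x+x^{-1})^2\right)^2\right)$$ $$=\frac{4}{\pi}\int_{0}^{v}\frac{\tan^{-1}(u)}{u}\,du-\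frac{8}{\pi^2}\mathrm{TS}(v,1)+\frac{4}{\pi}\int_{0}^{\pi/2}\log\left(1+v\sin(\theta)\right)d\theta+\log(2).$$
   Context: For a nonzero Laurent polynomial $P$ in $n$ variables, its (logarithmic) Mahler measure is $\mathrm{m}(P)=\int_0^1\cdots\int_0^1\log|P(e^{2\pi i\theta_1},\dots,e^{2\pi i\theta_n})|\,d\theta_1\cdots d\theta_n$, the integration being over all variables $x,y,z$ that occur. The function $\mathrm{TS}$ is defined by $\mathrm{TS}(v,w)=\int_0^1\frac{\tan^{-1}(vx)\sin^{-1}(wx)}{x}\,dx$. Here $\tan^{-1}$, $\sin^{-1}$ are the principal inverse functions and $\log$ is the natural logarithm. *)

theory Defs
  imports "HOL-Analysis.Analysis" "HOL-Library.Poly_Mapping"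
begin

text \<open>
  A monomial is a finitely supported exponent vector indexed by the variables
  \<open>0, 1, 2, \<dots>\<close>, with integer exponents. Complex Laurent polynomials form the group ring of
  these exponent vectors; \<open>+\<close>, \<open>*\<close>, \<open>^\<close> are the ring operations of \<^theory>\<open>HOL-Library.Poly_Mapping\<close>.
\<close>

type_synonym laurent = "(nat \<Rightarrow>\<^sub>0 int) \<Rightarrow>\<^sub>0 complex"

definition lconst :: "complex \<Rightarrow> laurent"
  where "lconst c = Poly_Mapping.single 0 c"

definition lvar :: "nat \<Rightarrow> laurent"
  where "lvar i = Poly_Mapping.single (Poly_Mapping.single i 1) 1"

definition lvar_inv :: "nat \<Rightarrow> laurent"
  where "lvar_inv i = Poly_Mapping.single (Poly_Mapping.single i (- 1)) 1"

lemma lvar_mult_lvar_inv: "lvar i * lvar_inv i = 1"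
  by (simp add: lvar_def lvar_inv_def mult_single flip: single_add single_one)

definition lvars :: "laurent \<Rightarrow> nat set"
  where "lvars P = (\<Union>e\<in>Poly_Mapping.keys P. Poly_Mapping.keys e)"

definition leval :: "laurent \<Rightarrow> (nat \<Rightarrow> complex) \<Rightarrow> complex"
  where "leval P w =
    (\<Sum>e\<in>Poly_Mapping.keys P. Poly_Mapping.lookup P e *
       (\<Prod>i\<in>Poly_Mapping.keys e. w i powi Poly_Mapping.lookup e i))"

text \<open>
  The integral is taken over one angle in \<open>[0, 1]\<close> for each variable that occurs in \<open>P\<close>.
  For \<open>P \<noteq> 0\<close> the zero set of \<open>P\<close> on the torus is a null set and \<open>log \<bar>P\<bar>\<close> is integrable,
  so the convention \<open>ln 0 = 0\<close> is harmless and the iterated integral is this product integral.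
\<close>

definition mahler :: "laurent \<Rightarrow> real"
  where "mahler P =
    (\<integral>\<theta>. ln (cmod (leval P (\<lambda>i. exp (2 * complex_of_real pi * \<i> * complex_of_real (\<theta> i)))))
      \<partial>(\<Pi>\<^sub>M i\<in>lvars P. restrict_space lborel {0..1}))"

definition TS :: "real \<Rightarrow> real \<Rightarrow> real"
  where "TS v w = integral {0..1} (\<lambda>x. arctan (v * x) * arcsin (w * x) / x)"

abbreviation X :: laurent where "X \<equiv> lvar 0"
abbreviation Y :: laurent where "Y \<equiv> lvar 1"
abbreviation Z :: laurent where "Z \<equiv> lvar 2"
abbreviation X_inv :: laurent where "X_inv \<equiv> lvar_inv 0"
abbreviation Y_inv :: laurent where "Y_inv \<equiv> lvar_inv 1"
abbreviation Z_inv :: laurent where "Z_inv \<equiv> lvar_inv 2"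

end

(*
Measures on the circle are normalised, and averages are taken over it. In each identity the polynomial
is, in one of its variables, linear or of the form d (w - 1/w) + c (or a difference of squares of linear
forms), so Jensen's formula evaluates the innermost average. Up to elementary terms this leaves the
average over y of ln (1 + c^2 + 2 c |Re y|) or of arsinh (c |Re y|), both of which are multiples of
TI c, the integral of arctan u / u over [0, c]; here c is v |Re x|. Averaging TI (v |Re x|) over x by
parts, with the substitution cos, produces TI v and TS v 1.
*)

theory Submission
  imports Defs "HOL-Probability.Probability"
begin

section \<open>Evaluation of Laurent polynomials and the torus measure\<close>

text \<open>The obstacle is integrability. \<open>ln (cmod P)\<close> is unbounded below near the
  zeros of P, and nothing is known beforehand about its integrability over the torus. It is bounded
  above, though, so averages are carried as \<open>has_bochner_integral\<close> facts, which hold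
  integrability and value together, and are stacked by Tonelli applied to an upper bound minus the
  function. A second obstacle is that variables drop out of the polynomials when v = 0; the Mahler
  measure is therefore always replaced by an average over three circles, whichever variables occur,
  and this also leaves the choice of the innermost variable free: x in the first identity, z in the
  second and fourth, y in the third and fifth. The fifth identity needs one mean that Jensen's
  formula does not give directly, that of the logarithm of an elliptical radius plus a multiple of
  |Re|; it is read off from a torus average whose two orders of integration are both
  accessible.\<close>

lemma leval_add: "leval (P + Q) w = leval P w + leval Q w"
  unfolding leval_def
  by (rule setsum_keys_plus_distrib) (auto simp: algebra_simps)

lemma leval_zero [simp]: "leval 0 w = 0"
  by (simp add: leval_def)

lemma leval_diff: "leval (P - Q) w = leval P w - leval Q w"
  using leval_add[of "P - Q" Q w] by simp

lemma leval_sum: "leval (sum f A) w = (\<Sum>a\<in>A. leval (f a) w)"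
  by (induction A rule: infinite_finite_induct) (auto simp: leval_add)

lemma leval_single:
  "leval (Poly_Mapping.single e c) w =
     c * (\<Prod>i\<in>Poly_Mapping.keys e. w i powi Poly_Mapping.lookup e i)"
  by (simp add: leval_def)

text \<open>Exponents may be negative, so w^(m + n) = w^m w^n calls for nonzero coordinates. By
  bilinearity the claim reduces to products of two monomials.\<close>

lemma leval_mult:
  assumes w: "\<And>i. w i \<noteq> 0"
  shows "leval (P * Q) w = leval P w * leval Q w"
proof -
  have expand: "P = (\<Sum>e\<in>Poly_Mapping.keys P. Poly_Mapping.single e (Poly_Mapping.lookup P e))"
    for P :: laurent
    by (rule poly_mapping_eqI)
       (auto simp: lookup_sum lookup_single when_def in_keys_iff)
  have mon: "(\<Prod>i\<in>Poly_Mapping.keys (d + e). w i powi Poly_Mapping.lookup (d + e) i) =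
      (\<Prod>i\<in>Poly_Mapping.keys d. w i powi Poly_Mapping.lookup d i) *
      (\<Prod>i\<in>Poly_Mapping.keys e. w i powi Poly_Mapping.lookup e i)" for d e
  proof -
    \<comment> \<open>Exponents can cancel in \<open>d + e\<close>, which then has fewer keys than
      \<open>d\<close> and \<open>e\<close> together; all three products are padded to the union by
      factors with exponent 0.\<close>
    let ?K = "Poly_Mapping.keys d \<union> Poly_Mapping.keys e"
    have ext: "(\<Prod>i\<in>Poly_Mapping.keys f. w i powi Poly_Mapping.lookup f i) =
        (\<Prod>i\<in>?K. w i powi Poly_Mapping.lookup f i)" if "Poly_Mapping.keys f \<subseteq> ?K" for f
      by (rule prod.mono_neutral_left) (use that in \<open>auto simp: in_keys_iff\<close>)
    show ?thesis
      by (subst (1 2 3) ext)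
         (use keys_add[of d e] in \<open>auto simp: lookup_add power_int_add w prod.distrib\<close>)
  qed
  have leval_expand: "leval P w = (\<Sum>e\<in>Poly_Mapping.keys P.
      leval (Poly_Mapping.single e (Poly_Mapping.lookup P e)) w)" for P
    by (subst expand) (rule leval_sum)
  have "leval (P * Q) w = (\<Sum>d\<in>Poly_Mapping.keys P. \<Sum>e\<in>Poly_Mapping.keys Q.
      leval (Poly_Mapping.single d (Poly_Mapping.lookup P d) *
             Poly_Mapping.single e (Poly_Mapping.lookup Q e)) w)"
    by (subst expand[of P], subst expand[of Q], subst sum_product) (simp add: leval_sum)
  also have "\<dots> = (\<Sum>d\<in>Poly_Mapping.keys P. \<Sum>e\<in>Poly_Mapping.keys Q.
      leval (Poly_Mapping.single d (Poly_Mapping.lookup P d)) w *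
      leval (Poly_Mapping.single e (Poly_Mapping.lookup Q e)) w)"
    by (simp add: mult_single leval_single mon mult_ac)
  also have "\<dots> = leval P w * leval Q w"
    by (simp add: leval_expand[of P] leval_expand[of Q] sum_product)
  finally show ?thesis .
qed

lemma leval_one [simp]: "leval 1 w = 1"
  by (simp add: leval_def)

lemma leval_power:
  assumes "\<And>i. w i \<noteq> 0"
  shows "leval (P ^ n) w = leval P w ^ n"
  by (induction n) (auto simp: leval_mult assms)

lemma leval_numeral [simp]: "leval (numeral n) w = numeral n"
  by (simp add: leval_single flip: single_numeral)

lemma leval_lconst [simp]: "leval (lconst c) w = c"
  by (simp add: lconst_def leval_single)

lemma leval_lvar [simp]: "leval (lvar i) w = w i"
  by (simp add: lvar_def leval_single)

lemma leval_lvar_inv [simp]: "leval (lvar_inv i) w = inverse (w i)"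
  by (simp add: lvar_inv_def leval_single power_int_minus)

lemma leval_cong: "(\<And>i. i \<in> lvars P \<Longrightarrow> w i = w' i) \<Longrightarrow> leval P w = leval P w'"
  unfolding leval_def lvars_def
  by (intro sum.cong prod.cong arg_cong2[where f="(*)"] refl) (metis UN_I)

lemma lvars_add: "lvars (P + Q) \<subseteq> lvars P \<union> lvars Q"
  using keys_add[of P Q] by (auto simp: lvars_def)

lemma lvars_diff: "lvars (P - Q) \<subseteq> lvars P \<union> lvars Q"
  using keys_diff[of P Q] unfolding lvars_def
  by (metis UN_Un UN_mono subset_refl)

lemma lvars_mult: "lvars (P * Q) \<subseteq> lvars P \<union> lvars Q"
proof
  fix i assume "i \<in> lvars (P * Q)"
  then obtain e where e: "e \<in> Poly_Mapping.keys (P * Q)" "i \<in> Poly_Mapping.keys e"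
    by (auto simp: lvars_def)
  then obtain a b where ab: "e = a + b" "a \<in> Poly_Mapping.keys P" "b \<in> Poly_Mapping.keys Q"
    using keys_mult[of P Q] by blast
  have "i \<in> Poly_Mapping.keys a \<union> Poly_Mapping.keys b"
    using keys_add[of a b] e ab by auto
  with ab show "i \<in> lvars P \<union> lvars Q" by (auto simp: lvars_def)
qed

lemma lvars_one [simp]: "lvars 1 = {}"
  by (simp add: lvars_def)

lemma lvars_power: "lvars (P ^ n) \<subseteq> lvars P"
  by (induction n) (use lvars_mult in fastforce)+

lemma lvars_numeral [simp]: "lvars (numeral n) = {}"
  by (simp add: lvars_def flip: single_numeral)

lemma lvars_lconst [simp]: "lvars (lconst c) = {}"
  by (simp add: lconst_def lvars_def)

lemma lvars_lvar [simp]: "lvars (lvar i) = {i}"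
  by (simp add: lvar_def lvars_def)

lemma lvars_lvar_inv [simp]: "lvars (lvar_inv i) = {i}"
  by (simp add: lvar_inv_def lvars_def)

lemmas lvars_subset_intros =
  order.trans[OF lvars_add Un_least] order.trans[OF lvars_diff Un_least]
  order.trans[OF lvars_mult Un_least] order.trans[OF lvars_power]

section \<open>Normalised arc length on the unit circle\<close>

definition circ :: "real \<Rightarrow> complex"
  where "circ \<theta> = exp (2 * complex_of_real pi * \<i> * complex_of_real \<theta>)"

text \<open>The measure lives on all of the complex plane, so that its measurable sets are the Borel
  sets. The price is that |z| = 1 holds only almost everywhere
  (\<open>AE_circle_norm\<close>).\<close>

definition circle :: "complex measure"
  where "circle = distr (restrict_space lborel {0..1}) borel circ"

lemma circ_measurable [measurable]: "circ \<in> borel_measurable borel"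
  unfolding circ_def by measurable

lemma circ_measurable' [measurable]: "circ \<in> borel_measurable (restrict_space lborel {0..1})"
  by (simp add: measurable_restrict_space1)

lemma circ_measurable'' [measurable]: "circ \<in> borel_measurable (restrict_space borel {0..1})"
  by (simp add: measurable_restrict_space1)

lemma prob_space_unit_interval: "prob_space (restrict_space lborel {0..1::real})"
  by (rule prob_spaceI) (simp add: emeasure_restrict_space)

lemma sets_circle [measurable_cong, simp]: "sets circle = sets borel"
  and space_circle [simp]: "space circle = UNIV"
  by (simp_all add: circle_def)

interpretation circle: prob_space circle
  unfolding circle_def by (rule prob_space.prob_space_distr[OF prob_space_unit_interval]) simp

interpretation circle2: pair_prob_space circle circle ..

interpretation circle3: pair_prob_space "circle \<Otimes>\<^sub>M circle" circle ..

lemma norm_circ [simp]: "cmod (circ \<theta>) = 1"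
  by (simp add: circ_def)

lemma AE_circle_norm: "AE z in circle. cmod z = 1"
  unfolding circle_def by (subst AE_distr_iff) auto

text \<open>Only an inclusion of \<open>lvars P\<close> in three indices is assumed: variables that
  do not occur integrate to 1 under a probability measure. In the evaluation point, \<open>a\<close>
  and \<open>b\<close> go to the indices i and j, and \<open>c\<close> to k and to all indices
  outside the three, where P does not look.\<close>

lemma mahler_eqI:
  assumes ijk: "distinct [i, j, k]" and vars: "lvars P \<subseteq> {i, j, k}"
    and int: "has_bochner_integral ((circle \<Otimes>\<^sub>M circle) \<Otimes>\<^sub>M circle)
        (\<lambda>((a, b), c). ln (cmod (leval P ((\<lambda>_. c)(i := a, j := b))))) m"
  shows "mahler P = m"
proof -
  let ?U = "restrict_space lborel {0..1::real}"
  let ?I = "{i, j, k}"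
  interpret U: prob_space ?U by (rule prob_space_unit_interval)
  interpret UU: pair_prob_space ?U ?U ..
  interpret UUU: pair_prob_space "?U \<Otimes>\<^sub>M ?U" ?U ..
  interpret P: product_prob_space "\<lambda>_::nat. ?U" UNIV ..
  define f where "f \<theta> = ln (cmod (leval P (\<lambda>i. circ (\<theta> i))))" for \<theta> :: "nat \<Rightarrow> real"
  define g where "g = (\<lambda>((a::real, b), c). restrict ((\<lambda>_. c)(i := a, j := b)) ?I)"
  have lm: "(\<lambda>\<theta>. circ (\<theta> l)) \<in> borel_measurable (PiM L (\<lambda>_. ?U))" if "l \<in> L" for l L
    by (rule measurable_compose[OF measurable_component_singleton[OF that]]) simp
  have fm: "f \<in> borel_measurable (PiM L (\<lambda>_. ?U))" if L: "lvars P \<subseteq> L" for L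
  proof -
    have "circ (\<theta> l) \<noteq> 0" for \<theta> :: "nat \<Rightarrow> real" and l by (simp add: circ_def)
    hence eq: "circ (\<theta> l) powi n = (if n \<ge> 0 then circ (\<theta> l) ^ nat n else inverse (circ (\<theta> l)) ^ nat (- n))"
      for \<theta> :: "nat \<Rightarrow> real" and l n
      by (auto simp: power_int_def power_inverse)
    have "(\<lambda>\<theta>. circ (\<theta> l) powi n) \<in> borel_measurable (PiM L (\<lambda>_. ?U))" if "l \<in> L" for l n
      unfolding eq using lm[OF that] by (cases "n \<ge> 0") simp_all
    thus ?thesis
      unfolding f_def leval_def using L
      by (intro borel_measurable_ln measurable_compose[OF _ borel_measurable_norm]
           borel_measurable_sum borel_measurable_times borel_measurable_prod)
         (auto simp: lvars_def)
  qed
  have "mahler P = (\<integral>\<theta>. f \<theta> \<partial>PiM (lvars P) (\<lambda>_. ?U))"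
    by (simp add: mahler_def f_def circ_def)
  \<comment> \<open>The product over the occurring variables is a marginal of the product over all
    three.\<close>
  also have "PiM (lvars P) (\<lambda>_. ?U) = distr (PiM ?I (\<lambda>_. ?U)) (PiM (lvars P) (\<lambda>_. ?U)) (\<lambda>\<theta>. restrict \<theta> (lvars P))"
    by (rule P.distr_restrict) (use vars in auto)
  also have "(\<integral>\<theta>. f \<theta> \<partial>\<dots>) = (\<integral>\<theta>. f (restrict \<theta> (lvars P)) \<partial>PiM ?I (\<lambda>_. ?U))"
    by (rule integral_distr[OF measurable_restrict_subset[OF vars] fm]) simp
  also have "\<dots> = (\<integral>\<theta>. f \<theta> \<partial>PiM ?I (\<lambda>_. ?U))"
    unfolding f_def by (intro Bochner_Integration.integral_cong refl arg_cong[where f="\<lambda>x. ln (cmod x)"] leval_cong) simp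
  \<comment> \<open>A finite product measure is determined by its values on boxes, so regrouping
    nested pairs as functions on the three indices by \<open>g\<close> carries one product to the
    other.\<close>
  also have "PiM ?I (\<lambda>_. ?U) = distr ((?U \<Otimes>\<^sub>M ?U) \<Otimes>\<^sub>M ?U) (PiM ?I (\<lambda>_. ?U)) g"
  proof (rule P.PiM_eqI[symmetric])
    have gm: "g \<in> measurable ((?U \<Otimes>\<^sub>M ?U) \<Otimes>\<^sub>M ?U) (PiM ?I (\<lambda>_. ?U))"
      unfolding g_def split_beta
      by (rule measurable_restrict) (auto simp: fun_upd_def)
    fix A assume A: "\<And>i. i \<in> ?I \<Longrightarrow> A i \<in> sets ?U"
    have Aijk: "A i \<in> sets ?U" "A j \<in> sets ?U" "A k \<in> sets ?U"
      using A by blast+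
    have "g -` (Pi\<^sub>E ?I A) \<inter> space ((?U \<Otimes>\<^sub>M ?U) \<Otimes>\<^sub>M ?U) = (A i \<times> A j) \<times> A k"
      using Aijk[THEN sets.sets_into_space] ijk
      by (auto simp: g_def PiE_iff space_pair_measure)
    moreover have "emeasure ((?U \<Otimes>\<^sub>M ?U) \<Otimes>\<^sub>M ?U) ((A i \<times> A j) \<times> A k) =
        emeasure ?U (A i) * emeasure ?U (A j) * emeasure ?U (A k)"
      using Aijk by (simp add: U.emeasure_pair_measure_Times)
    ultimately show "emeasure (distr ((?U \<Otimes>\<^sub>M ?U) \<Otimes>\<^sub>M ?U) (PiM ?I (\<lambda>_. ?U)) g) (Pi\<^sub>E ?I A) =
        (\<Prod>i\<in>?I. emeasure ?U (A i))"
      using ijk A by (subst emeasure_distr) (auto simp: gm mult_ac intro!: sets_PiM_I_finite)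
  qed simp_all
  also have "(\<integral>\<theta>. f \<theta> \<partial>\<dots>) = (\<integral>\<theta>. f (g \<theta>) \<partial>((?U \<Otimes>\<^sub>M ?U) \<Otimes>\<^sub>M ?U))"
  proof (rule integral_distr)
    show "g \<in> measurable ((?U \<Otimes>\<^sub>M ?U) \<Otimes>\<^sub>M ?U) (PiM ?I (\<lambda>_. ?U))"
      unfolding g_def split_beta
      by (rule measurable_restrict) (auto simp: fun_upd_def)
  qed (use fm vars in auto)
  also have "\<dots> = (\<integral>\<theta>. (case \<theta> of ((a, b), c) \<Rightarrow> ln (cmod (leval P ((\<lambda>_. c)(i := a, j := b)))))
      \<partial>distr ((?U \<Otimes>\<^sub>M ?U) \<Otimes>\<^sub>M ?U) ((circle \<Otimes>\<^sub>M circle) \<Otimes>\<^sub>M circle) (\<lambda>((a, b), c). ((circ a, circ b), circ c)))"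
  proof -
    have "f (g ((a, b), c)) = ln (cmod (leval P ((\<lambda>_. circ c)(i := circ a, j := circ b))))" for a b c
      unfolding f_def g_def
      by (intro arg_cong[where f="\<lambda>x. ln (cmod x)"] leval_cong) (use vars in auto)
    hence "(\<integral>\<theta>. f (g \<theta>) \<partial>((?U \<Otimes>\<^sub>M ?U) \<Otimes>\<^sub>M ?U)) =
      (\<integral>\<theta>. (case case \<theta> of ((a, b), c) \<Rightarrow> ((circ a, circ b), circ c) of
        ((a, b), c) \<Rightarrow> ln (cmod (leval P ((\<lambda>_. c)(i := a, j := b))))) \<partial>((?U \<Otimes>\<^sub>M ?U) \<Otimes>\<^sub>M ?U))"
      by (intro Bochner_Integration.integral_cong) auto
    also have "\<dots> = (\<integral>\<theta>. (case \<theta> of ((a, b), c) \<Rightarrow> ln (cmod (leval P ((\<lambda>_. c)(i := a, j := b)))))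
      \<partial>distr ((?U \<Otimes>\<^sub>M ?U) \<Otimes>\<^sub>M ?U) ((circle \<Otimes>\<^sub>M circle) \<Otimes>\<^sub>M circle) (\<lambda>((a, b), c). ((circ a, circ b), circ c)))"
    proof -
      let ?c = "\<lambda>((a, b), c). ((circ a, circ b), circ c)"
      have "?c \<in> measurable ((?U \<Otimes>\<^sub>M ?U) \<Otimes>\<^sub>M ?U) ((circle \<Otimes>\<^sub>M circle) \<Otimes>\<^sub>M circle)"
        unfolding split_beta by measurable
      from integral_distr[OF this borel_measurable_has_bochner_integral[OF int]]
      show ?thesis by (simp add: split_beta')
    qed
    finally show ?thesis .
  qed
  also have "distr ((?U \<Otimes>\<^sub>M ?U) \<Otimes>\<^sub>M ?U) ((circle \<Otimes>\<^sub>M circle) \<Otimes>\<^sub>M circle) (\<lambda>((a, b), c). ((circ a, circ b), circ c))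
     = (circle \<Otimes>\<^sub>M circle) \<Otimes>\<^sub>M circle"
  proof -
    have sfd: "sigma_finite_measure (distr ?U borel circ)"
      using circle.sigma_finite_measure_axioms by (simp add: circle_def)
    have c2: "circle \<Otimes>\<^sub>M circle = distr (?U \<Otimes>\<^sub>M ?U) (borel \<Otimes>\<^sub>M borel) (\<lambda>(a, b). (circ a, circ b))"
      unfolding circle_def by (rule pair_measure_distr) (auto intro: sfd)
    have "(circle \<Otimes>\<^sub>M circle) \<Otimes>\<^sub>M circle = distr (?U \<Otimes>\<^sub>M ?U) (borel \<Otimes>\<^sub>M borel) (\<lambda>(a, b). (circ a, circ b)) \<Otimes>\<^sub>M distr ?U borel circ"
      by (simp add: c2) (simp add: circle_def)
    also have "\<dots> = distr ((?U \<Otimes>\<^sub>M ?U) \<Otimes>\<^sub>M ?U) ((borel \<Otimes>\<^sub>M borel) \<Otimes>\<^sub>M borel) (\<lambda>(x, y). ((\<lambda>(a, b). (circ a, circ b)) x, circ y))"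
      by (rule pair_measure_distr) (auto intro: sfd)
    finally show ?thesis
      by (auto simp: split_beta intro!: distr_cong sets_pair_measure_cong)
  qed
  also have "(\<integral>\<theta>. (case \<theta> of ((a, b), c) \<Rightarrow> ln (cmod (leval P ((\<lambda>_. c)(i := a, j := b)))))
      \<partial>((circle \<Otimes>\<^sub>M circle) \<Otimes>\<^sub>M circle)) = m"
    using has_bochner_integral_integral_eq[OF int] by (simp add: split_beta')
  finally show ?thesis .
qed

section \<open>Invariance and iterated integrals\<close>

lemma circ_add: "circ (s + t) = circ s * circ t"
  by (simp add: circ_def exp_add ring_distribs)

lemma circ_uminus: "circ (- s) = cnj (circ s)"
  by (simp add: circ_def exp_cnj)

lemma circ_double: "circ (2 * s) = (circ s)\<^sup>2"
  using circ_add[of s s] by (simp add: power2_eq_square)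

lemma circ_eq_1_iff: "circ s = 1 \<longleftrightarrow> s \<in> \<int>"
  by (auto simp: circ_def exp_eq_1 Ints_def)

lemma circ_surj:
  assumes "cmod u = 1"
  obtains s where "0 \<le> s" "s < 1" "u = circ s"
proof
  show "u = circ (Arg2pi u / (2 * pi))"
    using Arg2pi_eq[of u] assms by (simp add: circ_def mult.commute)
qed (use Arg2pi[of u] in \<open>auto simp: field_simps\<close>)

lemma nn_integral_circle:
  assumes [measurable]: "f \<in> borel_measurable borel"
  shows "(\<integral>\<^sup>+z. f z \<partial>circle) = (\<integral>\<^sup>+t. f (circ t) * indicator {0..1} t \<partial>lborel)"
  unfolding circle_def
  by (subst nn_integral_distr) (auto simp: nn_integral_restrict_space)

text \<open>By periodicity only the fractional part r of s matters; the piece of [r, r + 1) beyond 1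
  is moved back to [0, r).\<close>

lemma nn_integral_circle_shift:
  assumes [measurable]: "f \<in> borel_measurable borel"
  shows "(\<integral>\<^sup>+t. f (circ t) * indicator {s..<s + 1} t \<partial>lborel) = (\<integral>\<^sup>+z. f z \<partial>circle)"
proof -
  have [measurable]: "f \<in> borel_measurable borel" by fact
  define n where "n = floor s"
  define r where "r = s - n"
  have r: "0 \<le> r" "r < 1" unfolding r_def n_def by linarith+
  have n1: "circ (of_int n + t) = circ t" "circ (1 + t) = circ t" for t
    by (simp_all add: circ_add circ_eq_1_iff)
  have "(\<integral>\<^sup>+t. f (circ t) * indicator {s..<s + 1} t \<partial>lborel)
      = (\<integral>\<^sup>+t. f (circ t) * indicator {r..<r + 1} t \<partial>lborel)"
    by (subst nn_integral_real_affine[where c=1 and t=n])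
       (auto simp: n1 indicator_def r_def intro!: nn_integral_cong)
  also have "\<dots> = (\<integral>\<^sup>+t. f (circ t) * indicator {r..<1} t + f (circ t) * indicator {1..<1 + r} t \<partial>lborel)"
    using r by (auto simp: indicator_def intro!: nn_integral_cong)
  also have "\<dots> = (\<integral>\<^sup>+t. f (circ t) * indicator {r..<1} t \<partial>lborel) + (\<integral>\<^sup>+t. f (circ t) * indicator {1..<1 + r} t \<partial>lborel)"
    by (rule nn_integral_add) auto
  also have "(\<integral>\<^sup>+t. f (circ t) * indicator {1..<1 + r} t \<partial>lborel) = (\<integral>\<^sup>+t. f (circ t) * indicator {0..<r} t \<partial>lborel)"
    by (subst nn_integral_real_affine[where c=1 and t=1])
       (auto simp: n1 indicator_def intro!: nn_integral_cong)
  also have "(\<integral>\<^sup>+t. f (circ t) * indicator {r..<1} t \<partial>lborel) + (\<integral>\<^sup>+t. f (circ t) * indicator {0..<r} t \<partial>lborel)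
      = (\<integral>\<^sup>+t. f (circ t) * indicator {r..<1} t + f (circ t) * indicator {0..<r} t \<partial>lborel)"
    by (rule nn_integral_add[symmetric]) auto
  \<comment> \<open>The pieces fill [0, 1); the closed endpoint 1 in the definition of
    \<open>circle\<close> is a null set.\<close>
  also have "\<dots> = (\<integral>\<^sup>+t. f (circ t) * indicator {0..1} t \<partial>lborel)"
    by (rule nn_integral_cong_AE, rule AE_mp[OF AE_lborel_singleton[of 1]], rule AE_I2)
       (use r in \<open>auto simp: indicator_def\<close>)
  finally show ?thesis by (simp add: nn_integral_circle)
qed

lemma distr_circle_eqI:
  assumes [measurable]: "T \<in> borel_measurable borel"
    and eq: "\<And>f :: complex \<Rightarrow> ennreal. f \<in> borel_measurable borel \<Longrightarrow>
      (\<integral>\<^sup>+z. f (T z) \<partial>circle) = (\<integral>\<^sup>+z. f z \<partial>circle)"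
  shows "distr circle circle T = circle"
proof (rule measure_eqI)
  fix A assume A: "A \<in> sets (distr circle circle T)"
  hence [measurable]: "A \<in> sets borel" by simp
  have "emeasure (distr circle circle T) A = (\<integral>\<^sup>+z. indicator A z \<partial>distr circle circle T)"
    by (simp add: nn_integral_indicator)
  also have "\<dots> = (\<integral>\<^sup>+z. indicator A (T z) \<partial>circle)"
    by (rule nn_integral_distr) auto
  also have "\<dots> = emeasure circle A"
    by (subst eq) auto
  finally show "emeasure (distr circle circle T) A = emeasure circle A" .
qed simp

lemma nn_integral_circle_rotate:
  assumes u: "cmod u = 1" and [measurable]: "f \<in> borel_measurable borel"
  shows "(\<integral>\<^sup>+z. f (u * z) \<partial>circle) = (\<integral>\<^sup>+z. f z \<partial>circle)"
proof -
  obtain s where s: "u = circ s" using circ_surj[OF u] by metis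
  have "(\<integral>\<^sup>+z. f (u * z) \<partial>circle) = (\<integral>\<^sup>+t. f (u * circ t) * indicator {0..<0 + 1} t \<partial>lborel)"
    by (rule nn_integral_circle_shift[symmetric]) simp
  also have "\<dots> = (\<integral>\<^sup>+t. f (circ t) * indicator {s..<s + 1} t \<partial>lborel)"
    by (subst (2) nn_integral_real_affine[where c=1 and t=s])
       (auto simp: s circ_add indicator_def intro!: nn_integral_cong)
  also have "\<dots> = (\<integral>\<^sup>+z. f z \<partial>circle)"
    by (rule nn_integral_circle_shift) simp
  finally show ?thesis .
qed

lemma distr_circle_rotate: "cmod u = 1 \<Longrightarrow> distr circle circle ((*) u) = circle"
  by (rule distr_circle_eqI) (auto intro: nn_integral_circle_rotate)

lemma borel_measurable_cnj [measurable]: "cnj \<in> borel_measurable borel"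
  by (intro borel_measurable_continuous_onI continuous_intros)

lemma distr_circle_cnj: "distr circle circle cnj = circle"
proof (rule distr_circle_eqI)
  fix f :: "complex \<Rightarrow> ennreal" assume [measurable]: "f \<in> borel_measurable borel"
  have "(\<integral>\<^sup>+z. f (cnj z) \<partial>circle) = (\<integral>\<^sup>+t. f (cnj (circ t)) * indicator {0..1} t \<partial>lborel)"
    by (rule nn_integral_circle) simp
  also have "\<dots> = (\<integral>\<^sup>+t. f (circ t) * indicator {-1..0} t \<partial>lborel)"
    by (subst (2) nn_integral_real_affine[where c="-1" and t=0])
       (auto simp: circ_uminus indicator_def intro!: nn_integral_cong)
  also have "\<dots> = (\<integral>\<^sup>+t. f (circ t) * indicator {-1..<-1 + 1} t \<partial>lborel)"
    by (rule nn_integral_cong_AE, rule AE_mp[OF AE_lborel_singleton[of 0]], rule AE_I2)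
       (auto simp: indicator_def)
  also have "\<dots> = (\<integral>\<^sup>+z. f z \<partial>circle)"
    by (rule nn_integral_circle_shift) simp
  finally show "(\<integral>\<^sup>+z. f (cnj z) \<partial>circle) = (\<integral>\<^sup>+z. f z \<partial>circle)" .
qed simp

text \<open>Squaring doubles the angle. Two consecutive periods of f give \<open>?I + ?I\<close>,
  and the substitution of 2 t for t turns them into one period of f composed with squaring, with
  Jacobian 2.\<close>

lemma distr_circle_square: "distr circle circle (\<lambda>z. z\<^sup>2) = circle"
proof (rule distr_circle_eqI)
  fix f :: "complex \<Rightarrow> ennreal" assume [measurable]: "f \<in> borel_measurable borel"
  let ?J = "\<integral>\<^sup>+z. f (z\<^sup>2) \<partial>circle" and ?I = "\<integral>\<^sup>+z. f z \<partial>circle"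
  have "?I + ?I = (\<integral>\<^sup>+t. f (circ t) * indicator {0..<0 + 1} t \<partial>lborel) + (\<integral>\<^sup>+t. f (circ t) * indicator {1..<1 + 1} t \<partial>lborel)"
    by (subst (1 2) nn_integral_circle_shift) simp_all
  also have "\<dots> = (\<integral>\<^sup>+t. f (circ t) * indicator {0..<0 + 1} t + f (circ t) * indicator {1..<1 + 1} t \<partial>lborel)"
    by (rule nn_integral_add[symmetric]) auto
  also have "\<dots> = (\<integral>\<^sup>+t. f (circ t) * indicator {0..<2} t \<partial>lborel)"
    by (intro nn_integral_cong) (auto simp: indicator_def)
  also have "\<dots> = 2 * (\<integral>\<^sup>+t. f ((circ t)\<^sup>2) * indicator {0..<0 + 1} t \<partial>lborel)"
    by (subst nn_integral_real_affine[where c=2 and t=0])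
       (auto simp: indicator_def circ_double intro!: nn_integral_cong arg_cong[where f="(*) 2"])
  also have "(\<integral>\<^sup>+t. f ((circ t)\<^sup>2) * indicator {0..<0 + 1} t \<partial>lborel) = ?J"
    by (rule nn_integral_circle_shift) simp
  finally have "2 * ?I = 2 * ?J" by (simp add: mult_2)
  thus "?J = ?I" by (simp add: ennreal_mult_cancel_left)
qed simp

lemma has_bochner_integral_circle_comp:
  fixes f :: "complex \<Rightarrow> real"
  assumes T: "distr circle circle T = circle" and [measurable]: "T \<in> borel_measurable borel"
    and f: "has_bochner_integral circle f c"
  shows "has_bochner_integral circle (\<lambda>z. f (T z)) c"
proof -
  have [measurable]: "f \<in> borel_measurable borel"
    using borel_measurable_has_bochner_integral[OF f] by simp
  have "has_bochner_integral (distr circle circle T) f c" by (simp add: T f)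
  thus ?thesis
    by (simp add: has_bochner_integral_iff integrable_distr_eq integral_distr)
qed

lemma has_bochner_integral_circle_rotate:
  fixes f :: "complex \<Rightarrow> real"
  shows "cmod u = 1 \<Longrightarrow> has_bochner_integral circle f c \<Longrightarrow>
    has_bochner_integral circle (\<lambda>z. f (u * z)) c"
  by (rule has_bochner_integral_circle_comp[OF distr_circle_rotate, where f=f]) auto

lemma has_bochner_integral_circle_cnj:
  fixes f :: "complex \<Rightarrow> real"
  shows "has_bochner_integral circle f c \<Longrightarrow> has_bochner_integral circle (\<lambda>z. f (cnj z)) c"
  by (rule has_bochner_integral_circle_comp[OF distr_circle_cnj, where f=f])
     simp_all

lemma has_bochner_integral_circle_square:
  fixes f :: "complex \<Rightarrow> real"
  shows "has_bochner_integral circle f c \<Longrightarrow> has_bochner_integral circle (\<lambda>z. f (z\<^sup>2)) c"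
  by (rule has_bochner_integral_circle_comp[OF distr_circle_square, where f=f]) auto

text \<open>The angles of a point of the circle form a coset of the integers, which is
  countable.\<close>

lemma AE_circle_neq: "AE z in circle. z \<noteq> u"
proof (cases "cmod u = 1")
  case False
  thus ?thesis by (intro AE_mp[OF AE_circle_norm AE_I2]) auto
next
  case True
  then obtain s where s: "u = circ s" using circ_surj by metis
  have "countable ((+) s ` \<int>)" by (intro countable_image countable_int)
  hence "AE t in lborel. t \<notin> (+) s ` \<int>"
    by (intro AE_not_in countable_imp_null_set_lborel)
  hence "AE t in lborel. circ t \<noteq> u"
  proof eventually_elim
    case (elim t)
    have "circ t = circ s * circ (t - s)" by (simp flip: circ_add)
    hence "circ t = u \<longleftrightarrow> circ (t - s) = 1" by (simp add: s circ_def)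
    moreover have "t = s + (t - s)" by simp
    ultimately show ?case using elim unfolding circ_eq_1_iff by (metis imageI)
  qed
  thus ?thesis
    unfolding circle_def by (subst AE_distr_iff) (auto simp: AE_restrict_space_iff)
qed

text \<open>For a function bounded above, Tonelli's theorem applies to the bound minus the function,
  so integrability over the product need not be known beforehand.\<close>

lemma has_bochner_integral_pairI:
  fixes f :: "'a \<times> 'b \<Rightarrow> real"
  assumes "prob_space M1" "prob_space M2"
    and [measurable]: "f \<in> borel_measurable (M1 \<Otimes>\<^sub>M M2)"
    and bdd: "AE x in M1. AE y in M2. f (x, y) \<le> B"
    and inner: "AE x in M1. has_bochner_integral M2 (\<lambda>y. f (x, y)) (g x)"
    and outer: "has_bochner_integral M1 g c"
  shows "has_bochner_integral (M1 \<Otimes>\<^sub>M M2) f c"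
proof -
  interpret M1: prob_space M1 by fact
  interpret M2: prob_space M2 by fact
  interpret pair_prob_space M1 M2 ..
  have gle: "AE x in M1. g x \<le> B"
    using bdd inner
  proof eventually_elim
    case (elim x)
    have "g x = (\<integral>y. f (x, y) \<partial>M2)" using elim(2) by (simp add: has_bochner_integral_iff)
    also have "\<dots> \<le> (\<integral>y. B \<partial>M2)"
      using elim by (intro integral_mono_AE) (auto simp: has_bochner_integral_iff)
    finally show ?case by (simp add: M2.prob_space)
  qed
  have cle: "c \<le> B"
  proof -
    have "c = (\<integral>x. g x \<partial>M1)" using outer by (simp add: has_bochner_integral_iff)
    also have "\<dots> \<le> (\<integral>x. B \<partial>M1)"
      using gle outer by (intro integral_mono_AE) (auto simp: has_bochner_integral_iff)
    finally show ?thesis by (simp add: M1.prob_space)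
  qed
  have "(\<integral>\<^sup>+p. ennreal (B - f p) \<partial>(M1 \<Otimes>\<^sub>M M2)) = (\<integral>\<^sup>+x. \<integral>\<^sup>+y. ennreal (B - f (x, y)) \<partial>M2 \<partial>M1)"
    by (rule M2.nn_integral_fst[symmetric]) simp
  also have "\<dots> = (\<integral>\<^sup>+x. ennreal (B - g x) \<partial>M1)"
  proof (rule nn_integral_cong_AE)
    show "AE x in M1. (\<integral>\<^sup>+y. ennreal (B - f (x, y)) \<partial>M2) = ennreal (B - g x)"
      using bdd inner
    proof eventually_elim
      case (elim x)
      show ?case using elim
        by (subst nn_integral_eq_integral) (auto simp: has_bochner_integral_iff M2.prob_space)
    qed
  qed
  also have "\<dots> = ennreal (B - c)"
    using gle outer by (subst nn_integral_eq_integral) (auto simp: has_bochner_integral_iff M1.prob_space)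
  finally have 1: "(\<integral>\<^sup>+p. ennreal (B - f p) \<partial>(M1 \<Otimes>\<^sub>M M2)) = ennreal (B - c)" .
  have "AE p in M1 \<Otimes>\<^sub>M M2. f p \<le> B"
    by (rule AE_pair_measure) (use bdd in auto)
  hence "has_bochner_integral (M1 \<Otimes>\<^sub>M M2) (\<lambda>p. B - f p) (B - c)"
    using 1 cle by (intro has_bochner_integral_nn_integral) auto
  moreover have "has_bochner_integral (M1 \<Otimes>\<^sub>M M2) (\<lambda>_. B) B"
    by (simp add: has_bochner_integral_iff prob_space)
  ultimately have "has_bochner_integral (M1 \<Otimes>\<^sub>M M2) (\<lambda>p. B - (B - f p)) (B - (B - c))"
    by (rule has_bochner_integral_diff[rotated])
  thus ?thesis by simp
qed

text \<open>Fubini in the opposite order: once the product integral is known, the mean of the other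
  inner integral is known too. This gives means that resist direct evaluation.\<close>

lemma has_bochner_integral_pair_swapI:
  fixes f :: "'a \<times> 'b \<Rightarrow> real"
  assumes "prob_space M1" "prob_space M2"
    and f: "has_bochner_integral (M1 \<Otimes>\<^sub>M M2) f c"
    and inner: "AE y in M2. (\<integral>x. f (x, y) \<partial>M1) = g y"
    and [measurable]: "g \<in> borel_measurable M2"
  shows "has_bochner_integral M2 g c"
proof -
  interpret M1: prob_space M1 by fact
  interpret M2: prob_space M2 by fact
  interpret pair_prob_space M1 M2 ..
  have int: "integrable (M1 \<Otimes>\<^sub>M M2) f" "(\<integral>p. f p \<partial>(M1 \<Otimes>\<^sub>M M2)) = c"
    using f by (auto simp: has_bochner_integral_iff)
  have "integrable M2 (\<lambda>y. \<integral>x. f (x, y) \<partial>M1)" "(\<integral>y. \<integral>x. f (x, y) \<partial>M1 \<partial>M2) = c"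
    using integrable_snd[of "\<lambda>x y. f (x, y)"] integral_snd[of "\<lambda>x y. f (x, y)"] int by auto
  hence "has_bochner_integral M2 (\<lambda>y. \<integral>x. f (x, y) \<partial>M1) c"
    by (simp add: has_bochner_integral_iff)
  note this [THEN borel_measurable_has_bochner_integral, measurable] and int = this
  show ?thesis
    by (rule has_bochner_integral_cong_AE[THEN iffD1, OF _ _ inner int]) simp_all
qed

text \<open>With y fixed in the outer integral, multiplication of w by y is a rotation. The map
  serves to replace a pair (z, y) by (y w, y), which makes y + z a product.\<close>

lemma distr_torus_shear:
  "distr (circle \<Otimes>\<^sub>M circle) (circle \<Otimes>\<^sub>M circle) (\<lambda>(w, y). (y * w, y)) = circle \<Otimes>\<^sub>M circle"
proof (rule measure_eqI)
  fix A assume A: "A \<in> sets (distr (circle \<Otimes>\<^sub>M circle) (circle \<Otimes>\<^sub>M circle) (\<lambda>(w, y). (y * w, y)))"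
  hence A' [measurable]: "A \<in> sets (circle \<Otimes>\<^sub>M circle)" by simp
  have sm: "(\<lambda>(w, y). (y * w, y)) \<in> measurable (circle \<Otimes>\<^sub>M circle) (circle \<Otimes>\<^sub>M circle)"
    by measurable
  have "emeasure (distr (circle \<Otimes>\<^sub>M circle) (circle \<Otimes>\<^sub>M circle) (\<lambda>(w, y). (y * w, y))) A
      = (\<integral>\<^sup>+p. indicator A (case p of (w, y) \<Rightarrow> (y * w, y)) \<partial>(circle \<Otimes>\<^sub>M circle))"
    by (subst nn_integral_distr[OF sm, symmetric]) (simp add: A', rule nn_integral_indicator[symmetric, OF A])
  also have "\<dots> = (\<integral>\<^sup>+y. \<integral>\<^sup>+w. indicator A (y * w, y) \<partial>circle \<partial>circle)"
  proof -
    have "(\<lambda>p. indicator A (case p of (w, y) \<Rightarrow> (y * w, y)) :: ennreal) \<in> borel_measurable (circle \<Otimes>\<^sub>M circle)"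
      by (rule measurable_compose[OF sm borel_measurable_indicator[OF A']])
    from circle2.nn_integral_snd[OF this] show ?thesis by simp
  qed
  also have "\<dots> = (\<integral>\<^sup>+y. \<integral>\<^sup>+w. indicator A (w, y) \<partial>circle \<partial>circle)"
  proof (rule nn_integral_cong_AE, rule AE_mp[OF AE_circle_norm AE_I2], rule impI)
    fix y :: complex assume "cmod y = 1"
    thus "(\<integral>\<^sup>+w. indicator A (y * w, y) \<partial>circle) = (\<integral>\<^sup>+w. indicator A (w, y) \<partial>circle)"
      by (rule nn_integral_circle_rotate) measurable
  qed
  also have "\<dots> = (\<integral>\<^sup>+p. indicator A p \<partial>(circle \<Otimes>\<^sub>M circle))"
    using circle2.nn_integral_snd[of "indicator A"] by simp
  finally show "emeasure (distr (circle \<Otimes>\<^sub>M circle) (circle \<Otimes>\<^sub>M circle) (\<lambda>(w, y). (y * w, y))) A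
     = emeasure (circle \<Otimes>\<^sub>M circle) A" by (simp only: nn_integral_indicator[OF A'])
qed simp

section \<open>Jensen's formula on the circle\<close>

lemma measure_circle_UNIV [simp]: "measure circle UNIV = 1"
  using circle.prob_space by simp

lemma integrable_circle_bounded:
  fixes f :: "complex \<Rightarrow> real"
  assumes "f \<in> borel_measurable borel" and "\<And>z. cmod z = 1 \<Longrightarrow> \<bar>f z\<bar> \<le> B"
  shows "integrable circle f"
proof (rule circle.integrable_const_bound[where B=B])
  show "AE z in circle. norm (f z) \<le> B"
    by (rule AE_mp[OF AE_circle_norm AE_I2]) (use assms in auto)
qed (use assms in auto)

lemma AE_circle_linear_neq_0:
  assumes "a \<noteq> 0 \<or> b \<noteq> (0::complex)"
  shows "AE z in circle. a + b * z \<noteq> 0"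
proof (cases "b = 0")
  case False
  show ?thesis
  proof (rule AE_mp[OF AE_circle_neq[of "- a / b"] AE_I2], rule impI, rule notI)
    fix z assume "z \<noteq> - a / b" "a + b * z = 0"
    thus False using False by (auto simp: field_simps add_eq_0_iff2)
  qed
qed (use assms in auto)

lemma has_bochner_integral_circle_AE_cong:
  fixes f g :: "complex \<Rightarrow> real"
  assumes "has_bochner_integral circle f c" "AE z in circle. f z = g z" "g \<in> borel_measurable borel"
  shows "has_bochner_integral circle g c"
proof -
  have "f \<in> borel_measurable circle"
    using assms(1) by (rule borel_measurable_has_bochner_integral)
  thus ?thesis
    using assms by (subst (asm) has_bochner_integral_cong_AE[of f circle g]) auto
qed

text \<open>This is how an unknown mean is solved for: two evaluations of the same integrand give an
  equation.\<close>

lemma has_bochner_integral_circle_AE_unique: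
  fixes f g :: "complex \<Rightarrow> real"
  assumes f: "has_bochner_integral circle f c" and g: "has_bochner_integral circle g d"
    and "AE z in circle. f z = g z"
  shows "c = d"
proof -
  have "g \<in> borel_measurable borel"
    using borel_measurable_has_bochner_integral[OF g] by simp
  from has_bochner_integral_circle_AE_cong[OF f assms(3) this] show ?thesis
    using g by (rule has_bochner_integral_eq)
qed

text \<open>The modulus lies between 1 - r and 1 + r, and 1 + r \<le> 1 / (1 - r), so one constant
  serves for both signs.\<close>

lemma ln_norm_bounds:
  assumes "0 \<le> r" "r < 1" "cmod z = 1"
  shows "\<bar>ln (cmod (1 + of_real r * z))\<bar> \<le> - ln (1 - r)"
proof -
  have lo: "1 - r \<le> cmod (1 + of_real r * z)"
    using norm_diff_ineq[of 1 "of_real r * z"] assms by (simp add: norm_mult)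
  have hi: "cmod (1 + of_real r * z) \<le> 1 + r"
    using norm_triangle_ineq[of 1 "of_real r * z"] assms by (simp add: norm_mult)
  have "(1 + r) * (1 - r) \<le> 1" by (simp add: algebra_simps)
  hence "1 + r \<le> inverse (1 - r)" using assms by (simp add: field_simps)
  hence "ln (cmod (1 + of_real r * z)) \<le> ln (inverse (1 - r))"
    using lo hi assms by (subst ln_le_cancel_iff) auto
  also have "\<dots> = - ln (1 - r)" using assms by (simp add: ln_inverse)
  finally have "ln (cmod (1 + of_real r * z)) \<le> - ln (1 - r)" .
  moreover have "ln (1 - r) \<le> ln (cmod (1 + of_real r * z))"
    using lo assms by (subst ln_le_cancel_iff) auto
  ultimately show ?thesis by linarith
qed

text \<open>The factors \<open>- 1 * z\<close> are kept unsimplified to match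
  \<open>has_bochner_integral_circle_rotate\<close> with u = -1.\<close>

lemma norm_mult_conj_factor:
  "cmod (1 + of_real r * z) * cmod (1 + of_real r * (- 1 * z)) = cmod (1 + of_real (r\<^sup>2) * (- 1 * z\<^sup>2))"
  by (simp add: norm_mult[symmetric] algebra_simps power2_eq_square)

text \<open>By \<open>(1 + r z) (1 - r z) = 1 - r\<^sup>2 z\<^sup>2\<close> the circle mean \<open>h r\<close> of \<open>ln \<bar>1 + r z\<bar>\<close> satisfies
  \<open>2 h r = h (r\<^sup>2)\<close>, so that \<open>h r = h (r ^ 2 ^ n) / 2 ^ n\<close> tends to \<open>0\<close>.\<close>

lemma circle_mean_ln_one_plus_less:
  assumes r: "0 \<le> r" "r < 1"
  shows "has_bochner_integral circle (\<lambda>z. ln (cmod (1 + of_real r * z))) 0"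
proof -
  define f where "f r z = ln (cmod (1 + of_real r * z))" for r z
  define h where "h r = (\<integral>z. f r z \<partial>circle)" for r
  have [measurable]: "f r \<in> borel_measurable borel" for r
    unfolding f_def by measurable
  have int: "integrable circle (f r)" if "0 \<le> r" "r < 1" for r
    by (rule integrable_circle_bounded[where B="- ln (1 - r)"]) (use that ln_norm_bounds in \<open>auto simp: f_def\<close>)
  have hb: "has_bochner_integral circle (f r) (h r)" if "0 \<le> r" "r < 1" for r
    using int[OF that] by (simp add: has_bochner_integral_iff h_def)
  have bound: "\<bar>h r\<bar> \<le> - ln (1 - r)" if r: "0 \<le> r" "r < 1" for r
  proof -
    have "\<bar>h r\<bar> \<le> (\<integral>z. \<bar>f r z\<bar> \<partial>circle)" unfolding h_def by (rule integral_abs_bound)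
    also have "\<dots> \<le> (\<integral>z. - ln (1 - r) \<partial>circle)"
    proof (rule integral_mono_AE)
      show "AE z in circle. \<bar>f r z\<bar> \<le> - ln (1 - r)"
        by (rule AE_mp[OF AE_circle_norm AE_I2]) (use ln_norm_bounds[OF r] in \<open>auto simp: f_def\<close>)
    qed (use int[OF r] in auto)
    finally show ?thesis by (simp add: circle.prob_space)
  qed
  have dbl: "2 * h r = h (r\<^sup>2)" if r: "0 \<le> r" "r < 1" for r
  proof -
    have r2: "0 \<le> r\<^sup>2" "r\<^sup>2 < 1" using r by (auto simp: power_less_one_iff abs_square_less_1)
    have "has_bochner_integral circle (\<lambda>z. f r z + f r (- 1 * z)) (h r + h r)"
      by (intro has_bochner_integral_add hb has_bochner_integral_circle_rotate r) simp
    moreover have "has_bochner_integral circle (\<lambda>z. f (r\<^sup>2) (- 1 * z\<^sup>2)) (h (r\<^sup>2))"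
      by (rule has_bochner_integral_circle_square[where f="\<lambda>w. f (r\<^sup>2) (- 1 * w)"],
          rule has_bochner_integral_circle_rotate) (use hb r2 in auto)
    moreover have "AE z in circle. f r z + f r (- 1 * z) = f (r\<^sup>2) (- 1 * z\<^sup>2)"
    proof (rule AE_mp[OF AE_circle_norm AE_I2], rule impI)
      fix z assume z: "cmod z = 1"
      have "1 + of_real r * w \<noteq> 0" if "cmod w = 1" for w
      proof
        assume "1 + of_real r * w = 0"
        hence "cmod (of_real r * w) = cmod (- 1)" by (metis add_eq_0_iff norm_minus_cancel)
        thus False using that r by (simp add: norm_mult)
      qed
      from this[of z] this[of "- 1 * z"] z
      show "f r z + f r (- 1 * z) = f (r\<^sup>2) (- 1 * z\<^sup>2)"
        unfolding f_def norm_mult_conj_factor[symmetric]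
        by (subst ln_mult_pos) auto
    qed
    ultimately have "h r + h r = h (r\<^sup>2)"
      by (rule has_bochner_integral_circle_AE_unique)
    thus ?thesis by simp
  qed
  have iter: "h r = h (r ^ (2 ^ n)) / 2 ^ n" for n
  proof (induction n)
    case (Suc n)
    have "2 * h (r ^ (2 ^ n)) = h ((r ^ (2 ^ n))\<^sup>2)"
      by (rule dbl) (use r in \<open>auto simp: power_less_one_iff\<close>)
    also have "(r ^ (2 ^ n))\<^sup>2 = r ^ (2 ^ Suc n)" by (simp flip: power_mult add: mult.commute)
    finally have "h (r ^ (2 ^ n)) = h (r ^ (2 ^ Suc n)) / 2" by simp
    thus ?case by (subst Suc.IH) (simp add: field_simps)
  qed simp
  have "\<bar>h r\<bar> \<le> - ln (1 - r) * (1 / 2) ^ n" for n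
  proof -
    have le: "r ^ (2 ^ n) \<le> r" using r power_decreasing[of 1 "2 ^ n" r] by simp
    have "\<bar>h r\<bar> = \<bar>h (r ^ (2 ^ n))\<bar> / 2 ^ n" by (subst iter[of n]) simp
    also have "\<dots> \<le> - ln (1 - r ^ (2 ^ n)) / 2 ^ n"
      by (intro divide_right_mono bound) (use r le in auto)
    also have "\<dots> \<le> - ln (1 - r) / 2 ^ n"
      by (intro divide_right_mono le_imp_neg_le) (use r le in auto)
    finally show ?thesis by (simp add: power_one_over)
  qed
  moreover have "(\<lambda>n. - ln (1 - r) * (1 / 2) ^ n) \<longlonglongrightarrow> - ln (1 - r) * 0"
    by (intro tendsto_mult tendsto_const LIMSEQ_power_zero) simp
  ultimately have "\<bar>h r\<bar> \<le> - ln (1 - r) * 0"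
    by (intro LIMSEQ_le_const) auto
  hence "h r = 0" by simp
  thus ?thesis using hb[OF r] unfolding f_def by simp
qed

text \<open>On the boundary \<open>r = 1\<close>, Fatou's lemma gives integrability, and then the doubling identity
  reads \<open>2 h 1 = h 1\<close>.\<close>

lemma circle_mean_ln_one_plus:
  "has_bochner_integral circle (\<lambda>z. ln (cmod (1 + z))) 0"
proof -
  define f where "f z = ln (cmod (1 + z))" for z
  \<comment> \<open>On the unit circle |1 + r z| \<le> 2 for r \<le> 1, so subtracting from
    \<open>ln 2\<close> gives the nonnegative functions that Fatou's lemma asks for.\<close>
  define g where "g r z = ln 2 - ln (cmod (1 + of_real r * z))" for r z
  have [measurable]: "f \<in> borel_measurable borel" "g r \<in> borel_measurable borel" for r
    unfolding f_def g_def by measurable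
  \<comment> \<open>Radii below 1 with limit 1: at each of them the mean of the logarithm is already
    known to be 0, so the integral of \<open>g (s n)\<close> is constantly
    \<open>ln 2\<close>.\<close>
  define s where "s n = 1 - inverse (real (Suc n))" for n
  have s: "0 \<le> s n" "s n < 1" for n by (auto simp: s_def field_simps)
  have slim: "s \<longlonglongrightarrow> 1"
    unfolding s_def using tendsto_diff[OF tendsto_const LIMSEQ_inverse_real_of_nat, of 1] by simp
  have gnn: "AE z in circle. 0 \<le> g r z" if "0 \<le> r" "r < 1" for r
  proof (rule AE_mp[OF AE_circle_norm AE_I2], rule impI)
    fix z assume z: "cmod z = 1"
    have "cmod (1 + of_real r * z) \<le> 2"
      using norm_triangle_ineq[of 1 "of_real r * z"] that z by (simp add: norm_mult)
    hence "ln (cmod (1 + of_real r * z)) \<le> ln 2"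
      by (cases "1 + of_real r * z = 0") (auto simp: ln_le_cancel_iff)
    thus "0 \<le> g r z" by (simp add: g_def)
  qed
  have gint: "(\<integral>\<^sup>+z. ennreal (g (s n) z) \<partial>circle) = ennreal (ln 2)" for n
  proof -
    have "has_bochner_integral circle (\<lambda>z. ln 2) (ln 2 :: real)"
      by (simp add: has_bochner_integral_iff circle.prob_space)
    hence "has_bochner_integral circle (g (s n)) (ln 2 - 0)"
      unfolding g_def using circle_mean_ln_one_plus_less[OF s] by (intro has_bochner_integral_diff)
    thus ?thesis
      using gnn[OF s, of n] by (subst nn_integral_eq_integral) (auto simp: has_bochner_integral_iff)
  qed
  have lim: "AE z in circle. liminf (\<lambda>n. ennreal (g (s n) z)) = ennreal (ln 2 - f z)"
  proof (rule AE_mp[OF AE_circle_neq[of "-1"] AE_I2], rule impI)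
    fix z :: complex assume "z \<noteq> - 1"
    hence "1 + of_real 1 * z \<noteq> 0" by (simp add: add_eq_0_iff)
    hence "(\<lambda>n. g (s n) z) \<longlonglongrightarrow> g 1 z"
      unfolding g_def by (intro tendsto_intros slim) auto
    hence "(\<lambda>n. ennreal (g (s n) z)) \<longlonglongrightarrow> ennreal (g 1 z)" by (rule tendsto_ennrealI)
    from lim_imp_Liminf[OF _ this] show "liminf (\<lambda>n. ennreal (g (s n) z)) = ennreal (ln 2 - f z)"
      by (simp add: g_def f_def)
  qed
  have "(\<integral>\<^sup>+z. ennreal (ln 2 - f z) \<partial>circle) = (\<integral>\<^sup>+z. liminf (\<lambda>n. ennreal (g (s n) z)) \<partial>circle)"
    by (rule nn_integral_cong_AE) (use lim in auto)
  also have "\<dots> \<le> liminf (\<lambda>n. \<integral>\<^sup>+z. ennreal (g (s n) z) \<partial>circle)"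
    by (rule nn_integral_liminf) simp
  also have "\<dots> = ennreal (ln 2)" by (simp add: gint Liminf_const)
  finally have fin: "(\<integral>\<^sup>+z. ennreal (ln 2 - f z) \<partial>circle) < \<infinity>"
    by (rule le_less_trans) simp
  have "AE z in circle. 0 \<le> ln 2 - f z"
  proof (rule AE_mp[OF AE_circle_norm AE_I2], rule impI)
    fix z assume z: "cmod z = 1"
    have "cmod (1 + z) \<le> 2" using norm_triangle_ineq[of 1 z] z by simp
    thus "0 \<le> ln 2 - f z"
      unfolding f_def by (cases "1 + z = 0") (auto simp: ln_le_cancel_iff)
  qed
  hence "integrable circle (\<lambda>z. ln 2 - f z)"
    using fin by (intro integrableI_nonneg) auto
  hence "integrable circle (\<lambda>z. ln 2 - (ln 2 - f z))"
    by (rule Bochner_Integration.integrable_diff[rotated]) simp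
  moreover have "(\<lambda>z. ln 2 - (ln 2 - f z)) = f" by auto
  ultimately have "integrable circle f" by metis
  then obtain I where I: "has_bochner_integral circle f I"
    by (auto simp: has_bochner_integral_iff)
  have "has_bochner_integral circle (\<lambda>z. f z + f (- 1 * z)) (I + I)"
    by (intro has_bochner_integral_add I has_bochner_integral_circle_rotate) simp
  moreover have "has_bochner_integral circle (\<lambda>z. f (- 1 * z\<^sup>2)) I"
    by (rule has_bochner_integral_circle_square[where f="\<lambda>w. f (- 1 * w)"],
        rule has_bochner_integral_circle_rotate) (use I in auto)
  \<comment> \<open>At z = 1 and z = -1 a factor vanishes, and the convention ln 0 = 0 breaks the
    additivity of the logarithm.\<close>
  moreover have "AE z in circle. f z + f (- 1 * z) = f (- 1 * z\<^sup>2)"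
  proof (rule AE_mp[OF AE_circle_neq[of 1]], rule AE_mp[OF AE_circle_neq[of "- 1"] AE_I2], intro impI)
    fix z :: complex assume "z \<noteq> -1" "z \<noteq> 1"
    moreover from this have "- z \<noteq> 1" by (metis minus_minus)
    ultimately have "1 + z \<noteq> 0" "1 + - 1 * z \<noteq> 0" by (auto simp: add_eq_0_iff)
    thus "f z + f (- 1 * z) = f (- 1 * z\<^sup>2)"
      using norm_mult_conj_factor[of 1 z] ln_mult_pos[of "cmod (1 + z)" "cmod (1 + - 1 * z)"]
      unfolding f_def by simp
  qed
  ultimately have "I + I = I"
    by (rule has_bochner_integral_circle_AE_unique)
  with I show ?thesis unfolding f_def by simp
qed

text \<open>Jensen's formula in degree one. If |b| \<le> |a|, factor out a and rotate the phase of b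
  / a away, which leaves 1 + r z with r \<le> 1. Otherwise |a + b z| = |b + a cnj z| on the circle
  exchanges the coefficients.\<close>

lemma circle_mean_ln_linear:
  assumes "a \<noteq> 0 \<or> b \<noteq> 0"
  shows "has_bochner_integral circle (\<lambda>z. ln (cmod (a + b * z))) (ln (max (cmod a) (cmod b)))"
proof -
  have main: "has_bochner_integral circle (\<lambda>z. ln (cmod (a + b * z))) (ln (cmod a))"
    if le: "cmod b \<le> cmod a" and a: "a \<noteq> 0" for a b
  proof -
    define r where "r = cmod (b / a)"
    \<comment> \<open>For b = 0 the quotient would be 0; the default 1 keeps u on the unit
      circle.\<close>
    define u where "u = (if b = 0 then 1 else (b / a) / of_real r)"
    have r: "0 \<le> r" "r \<le> 1" using le a by (auto simp: r_def norm_divide)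
    have u: "cmod u = 1" "b = a * of_real r * u" using a by (auto simp: u_def r_def norm_divide norm_mult)
    have "has_bochner_integral circle (\<lambda>z. ln (cmod (1 + of_real r * z))) 0"
      using circle_mean_ln_one_plus_less[of r] circle_mean_ln_one_plus r by (cases "r = 1") auto
    from has_bochner_integral_circle_rotate[OF u(1) this]
    have "has_bochner_integral circle (\<lambda>z. ln (cmod (1 + of_real r * (u * z)))) 0" .
    hence "has_bochner_integral circle (\<lambda>z. ln (cmod a) + ln (cmod (1 + of_real r * (u * z)))) (ln (cmod a) + 0)"
      by (intro has_bochner_integral_add) (auto simp: has_bochner_integral_iff circle.prob_space)
    moreover have "AE z in circle. ln (cmod a) + ln (cmod (1 + of_real r * (u * z))) = ln (cmod (a + b * z))"
    proof (rule AE_mp[OF AE_circle_linear_neq_0[of a b] AE_I2])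
      fix z show "a + b * z \<noteq> 0 \<longrightarrow> ln (cmod a) + ln (cmod (1 + of_real r * (u * z))) = ln (cmod (a + b * z))"
      proof
        assume nz: "a + b * z \<noteq> 0"
        have eq: "a + b * z = a * (1 + of_real r * (u * z))" by (subst u(2)) (simp add: algebra_simps)
        with nz show "ln (cmod a) + ln (cmod (1 + of_real r * (u * z))) = ln (cmod (a + b * z))"
          unfolding eq norm_mult by (subst ln_mult_pos) auto
      qed
    qed (use a in auto)
    ultimately show ?thesis
      by (intro has_bochner_integral_circle_AE_cong[where g="\<lambda>z. ln (cmod (a + b * z))"]) auto
  qed
  show ?thesis
  proof (cases "cmod b \<le> cmod a")
    case True
    moreover from this assms have "a \<noteq> 0" by auto
    ultimately show ?thesis using main by (simp add: max_def)
  next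
    case False
    hence b: "b \<noteq> 0" by auto
    have "has_bochner_integral circle (\<lambda>z. ln (cmod (b + a * cnj z))) (ln (cmod b))"
      by (rule has_bochner_integral_circle_cnj[where f="\<lambda>z. ln (cmod (b + a * z))"])
         (use main[of a b] b False in auto)
    moreover have "AE z in circle. ln (cmod (b + a * cnj z)) = ln (cmod (a + b * z))"
    proof (rule AE_mp[OF AE_circle_norm AE_I2], rule impI)
      fix z :: complex assume z: "cmod z = 1"
      have "z * cnj z = 1" using complex_norm_square[of z] z by simp
      hence "a + b * z = z * (b + a * cnj z)" by (simp add: algebra_simps)
      thus "ln (cmod (b + a * cnj z)) = ln (cmod (a + b * z))" using z by (simp add: norm_mult)
    qed
    ultimately have "has_bochner_integral circle (\<lambda>z. ln (cmod (a + b * z))) (ln (cmod b))"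
      by (rule has_bochner_integral_circle_AE_cong) simp
    thus ?thesis using False by (simp add: max_def)
  qed
qed

text \<open>With \<open>p q = d\<close> and \<open>p\<^sup>2 - q\<^sup>2 = c\<close> one has
  \<open>w (d (w - 1 / w) + c) = (p w - q) (q w + p)\<close>, and \<open>p\<^sup>2 + q\<^sup>2 = sqrt (c\<^sup>2 + 4 d\<^sup>2)\<close>.\<close>

lemma circle_mean_ln_quadratic:
  fixes c d :: real
  assumes "c \<noteq> 0 \<or> d \<noteq> 0"
  shows "has_bochner_integral circle (\<lambda>w. ln (cmod (of_real d * (w - inverse w) + of_real c)))
    (ln ((\<bar>c\<bar> + sqrt (c\<^sup>2 + 4 * d\<^sup>2)) / 2))"
proof -
  define R where "R = sqrt (c\<^sup>2 + 4 * d\<^sup>2)"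
  have R2: "R\<^sup>2 = c\<^sup>2 + 4 * d\<^sup>2" by (simp add: R_def)
  have Rc: "\<bar>c\<bar> \<le> R" unfolding R_def by (rule real_le_rsqrt) simp
  have R0: "R > 0" unfolding R_def using assms by (auto simp: sum_power2_gt_zero_iff add_nonneg_pos add_pos_nonneg)
  define p where "p = sqrt ((R + c) / 2)"
  \<comment> \<open>The product of the two square roots is |d|; the sign of d is put into q.\<close>
  define q where "q = (if d \<ge> 0 then 1 else -1) * sqrt ((R - c) / 2)"
  have p2: "p\<^sup>2 = (R + c) / 2" and q2: "q\<^sup>2 = (R - c) / 2"
    using Rc by (auto simp: p_def q_def power_mult_distrib)
  have pq: "p * q = d"
  proof -
    have "sqrt ((R + c) / 2) * sqrt ((R - c) / 2) = sqrt (d\<^sup>2)"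
      unfolding real_sqrt_mult[symmetric]
      by (rule arg_cong[where f=sqrt]) (use R2 in \<open>auto simp: field_simps power2_eq_square\<close>)
    thus ?thesis by (simp add: p_def q_def)
  qed
  have nz: "p \<noteq> 0 \<or> q \<noteq> 0" using p2 q2 R0 by (auto simp: power2_eq_square)
  have jp: "has_bochner_integral circle (\<lambda>w. ln (cmod (of_real (- q) + of_real p * w))) (ln (max \<bar>q\<bar> \<bar>p\<bar>))"
    using circle_mean_ln_linear[of "of_real (- q)" "of_real p"] nz by auto
  have jq: "has_bochner_integral circle (\<lambda>w. ln (cmod (of_real p + of_real q * w))) (ln (max \<bar>p\<bar> \<bar>q\<bar>))"
    using circle_mean_ln_linear[of "of_real p" "of_real q"] nz by auto
  have nz1: "AE w in circle. of_real (- q) + of_real p * w \<noteq> 0"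
    and nz2: "AE w in circle. of_real p + of_real q * w \<noteq> 0"
    using nz by (auto intro!: AE_circle_linear_neq_0 simp del: of_real_minus)
  \<comment> \<open>Both linear factors have the same Jensen value, so the sum is the logarithm of
    the larger of p^2 and q^2, that is, of (R + |c|) / 2.\<close>
  have val: "ln (max \<bar>q\<bar> \<bar>p\<bar>) + ln (max \<bar>p\<bar> \<bar>q\<bar>) = ln ((\<bar>c\<bar> + R) / 2)"
  proof -
    have "max \<bar>q\<bar> \<bar>p\<bar> * max \<bar>p\<bar> \<bar>q\<bar> = max (p\<^sup>2) (q\<^sup>2)"
    proof (cases "\<bar>p\<bar> \<le> \<bar>q\<bar>")
      case True
      thus ?thesis by (simp add: max_absorb1 max_absorb2 abs_le_square_iff power2_eq_square)
    next
      case False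
      hence "\<bar>q\<bar> \<le> \<bar>p\<bar>" by simp
      thus ?thesis by (simp add: max_absorb1 max_absorb2 abs_le_square_iff power2_eq_square)
    qed
    also have "\<dots> = (\<bar>c\<bar> + R) / 2" unfolding p2 q2 by (auto simp: max_def)
    finally have "ln (max \<bar>q\<bar> \<bar>p\<bar> * max \<bar>p\<bar> \<bar>q\<bar>) = ln ((\<bar>c\<bar> + R) / 2)"
      by (rule arg_cong)
    moreover have "0 < max \<bar>q\<bar> \<bar>p\<bar>" "0 < max \<bar>p\<bar> \<bar>q\<bar>" using nz by (auto simp: less_max_iff_disj)
    ultimately show ?thesis by (simp add: ln_mult_pos)
  qed
  have "has_bochner_integral circle
      (\<lambda>w. ln (cmod (of_real (- q) + of_real p * w)) + ln (cmod (of_real p + of_real q * w))) (ln ((\<bar>c\<bar> + R) / 2))"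
    using has_bochner_integral_add[OF jp jq] val by simp
  moreover have "AE w in circle. ln (cmod (of_real (- q) + of_real p * w)) + ln (cmod (of_real p + of_real q * w))
      = ln (cmod (of_real d * (w - inverse w) + of_real c))"
  proof (rule AE_mp[OF AE_circle_norm], rule AE_mp[OF nz1], rule AE_mp[OF nz2 AE_I2], intro impI)
    fix w :: complex
    assume w: "cmod w = 1" and n1: "of_real (- q) + of_real p * w \<noteq> 0" and n2: "of_real p + of_real q * w \<noteq> 0"
    have w0: "w \<noteq> 0" using w by auto
    have c: "c = p\<^sup>2 - q\<^sup>2" by (simp add: p2 q2 field_simps)
    have "(of_real (- q) + of_real p * w) * (of_real p + of_real q * w) = w * (of_real d * (w - inverse w) + of_real c)"
      unfolding c pq[symmetric] using w0 by (simp add: field_simps power2_eq_square)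
    hence "cmod (of_real (- q) + of_real p * w) * cmod (of_real p + of_real q * w)
        = cmod (of_real d * (w - inverse w) + of_real c)"
      using w by (simp flip: norm_mult) (simp add: norm_mult)
    thus "ln (cmod (of_real (- q) + of_real p * w)) + ln (cmod (of_real p + of_real q * w))
      = ln (cmod (of_real d * (w - inverse w) + of_real c))"
      using n1 n2 by (subst ln_mult_pos[symmetric]) auto
  qed
  ultimately show ?thesis
    unfolding R_def by (rule has_bochner_integral_circle_AE_cong) simp
qed

section \<open>The inverse tangent integral\<close>

text \<open>Division by zero yields 0 in HOL, so \<open>arctan u / u\<close> jumps at 0; here the
  gap is filled with the limit 1, which makes the fundamental theorem of calculus available on
  intervals that start at 0.\<close>

definition arctan_quot :: "real \<Rightarrow> real"
  where "arctan_quot x = (if x = 0 then 1 else arctan x / x)"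

text \<open>The classical inverse tangent integral, left with the raw integrand so that unfolding it
  yields the theorem verbatim. For c < 0 the interval is empty and the value is 0.\<close>

definition TI :: "real \<Rightarrow> real"
  where "TI c = integral {0..c} (\<lambda>u. arctan u / u)"

lemma isCont_arctan_quot: "isCont arctan_quot x"
proof (cases "x = 0")
  case True
  have "((\<lambda>h. (arctan (0 + h) - arctan 0) / h) \<longlongrightarrow> 1) (at 0)"
    using DERIV_arctan[of 0] unfolding DERIV_def by simp
  hence "(arctan_quot \<longlongrightarrow> 1) (at 0)"
    by (rule Lim_transform_eventually) (auto simp: arctan_quot_def eventually_at_filter)
  thus ?thesis using True by (simp add: isCont_def arctan_quot_def)
next
  case False
  have "eventually (\<lambda>y. y \<noteq> 0) (nhds x)"
    using False by (rule t1_space_nhds)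
  hence "eventually (\<lambda>y. arctan_quot y = arctan y / y) (nhds x)"
    by eventually_elim (simp add: arctan_quot_def)
  moreover have "isCont (\<lambda>y. arctan y / y) x"
    using False by (intro continuous_intros) auto
  ultimately show ?thesis by (simp add: isCont_cong)
qed

lemma continuous_on_arctan_quot [continuous_intros]:
  "continuous_on A f \<Longrightarrow> continuous_on A (\<lambda>x. arctan_quot (f x))"
  by (rule continuous_on_compose2[OF continuous_at_imp_continuous_on[of UNIV]])
     (auto intro: isCont_arctan_quot)

lemma TI_eq: "TI c = integral {0..c} arctan_quot"
  unfolding TI_def by (rule integral_spike[of "{0}"]) (auto simp: arctan_quot_def)

lemma TI_0 [simp]: "TI 0 = 0"
  by (simp add: TI_def)

lemma DERIV_TI:
  assumes "x \<in> {0..b}"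
  shows "(TI has_real_derivative arctan_quot x) (at x within {0..b})"
  unfolding TI_eq[abs_def]
  by (rule integral_has_real_derivative[OF _ assms]) (intro continuous_intros)

lemma continuous_on_TI: "continuous_on {0..} TI"
  unfolding continuous_on_eq_continuous_within
proof
  fix x :: real assume x: "x \<in> {0..}"
  have "continuous (at x within {0..x + 1}) TI"
    using DERIV_TI[of x "x + 1"] x by (intro DERIV_continuous) auto
  moreover have "at x within {0..x + 1} = at x within {0..}"
    by (rule at_within_nhd[of x "{..<x + 1}"]) auto
  ultimately show "continuous (at x within {0..}) TI" by simp
qed

text \<open>|cos| is even and has period pi, so the four quarters of the circle contribute equally.
  In the angle 2 pi t each quarter gives J / (2 pi), and four of them give 2 J / pi.\<close>

lemma circle_mean_Re:
  fixes g :: "real \<Rightarrow> real"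
  assumes g: "continuous_on UNIV g"
  shows "has_bochner_integral circle (\<lambda>z. g \<bar>Re z\<bar>) (2 / pi * integral {0..pi / 2} (\<lambda>\<phi>. g (cos \<phi>)))"
proof -
  define G where "G \<phi> = g \<bar>cos \<phi>\<bar>" for \<phi>
  define H where "H t = G (2 * pi * t)" for t
  have cG: "continuous_on A G" for A
    unfolding G_def by (intro continuous_on_compose2[OF g] continuous_intros) auto
  have cH: "continuous_on A H" for A
    unfolding H_def by (intro continuous_on_compose2[OF cG[of UNIV]] continuous_intros) auto
  define J where "J = integral {0..pi / 2} G"
  have J: "J = integral {0..pi / 2} (\<lambda>\<phi>. g (cos \<phi>))"
    unfolding J_def G_def by (intro integral_cong arg_cong[where f=g] abs_of_nonneg cos_ge_zero) auto
  have "(G has_integral J) (cbox 0 (pi / 2))"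
    unfolding J_def using cG by (simp add: integrable_integral integrable_continuous_interval)
  from has_integral_affinity'[OF this, of "2 * pi" 0]
  have 1: "(H has_integral J / (2 * pi)) {0..1/4}"
    by (simp add: H_def[abs_def] field_simps)
  have even: "H (- t) = H t" and shift: "H (t - 1/2) = H t" "H (t - 1) = H t" for t
  proof -
    show "H (- t) = H t" by (simp add: H_def G_def)
    have "2 * pi * (t - 1/2) = 2 * pi * t - pi" by (simp add: algebra_simps)
    thus "H (t - 1/2) = H t" unfolding H_def G_def by (simp only: cos_minus_pi abs_minus_cancel)
    have "2 * pi * (t - 1) = 2 * pi * t - 2 * pi" by (simp add: algebra_simps)
    moreover have "cos (x - 2 * pi) = cos x" for x :: real by (simp add: cos_diff)
    ultimately show "H (t - 1) = H t" unfolding H_def G_def by simp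
  qed
  have 2: "(H has_integral J / (2 * pi)) {-1/4..0}"
    using has_integral_reflect_real[where f=H and a=0 and b="1/4"] 1 by (simp add: even)
  have 3: "(H has_integral J / (2 * pi) + J / (2 * pi)) {-1/4..1/4}"
    by (rule has_integral_combine[OF _ _ 2 1]) auto
  have 4: "(H has_integral J / (2 * pi) + J / (2 * pi)) {1/4..3/4}"
    using has_integral_affinity'[of H _ "-1/4" "1/4" 1 "-1/2"] 3 by (simp add: shift)
  have 5: "(H has_integral J / (2 * pi)) {3/4..1}"
    using has_integral_affinity'[of H _ "-1/4" 0 1 "-1"] 2 by (simp add: shift)
  have "(H has_integral J / (2 * pi) + (J / (2 * pi) + J / (2 * pi)) + J / (2 * pi)) {0..1}"
    by (rule has_integral_combine[OF _ _ has_integral_combine[OF _ _ 1 4] 5]) auto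
  hence "integral {0..1} H = J / (2 * pi) + (J / (2 * pi) + J / (2 * pi)) + J / (2 * pi)"
    by (rule integral_unique)
  hence H: "integral {0..1} H = 2 / pi * J" by (simp add: field_simps)
  have int: "set_integrable lborel {0..1} H"
    unfolding set_integrable_def by (rule borel_integrable_compact) (auto intro: cH)
  have Hm: "H t = g \<bar>Re (circ t)\<bar>" for t
    by (simp add: H_def G_def circ_def Re_exp)
  have "has_bochner_integral (restrict_space lborel {0..1}) H (2 / pi * J)"
    using int set_borel_integral_eq_integral(2)[OF int]
    by (simp add: has_bochner_integral_iff integrable_restrict_space integral_restrict_space
        set_integrable_def set_lebesgue_integral_def H)
  hence hb: "has_bochner_integral (restrict_space lborel {0..1}) (\<lambda>t. g \<bar>Re (circ t)\<bar>) (2 / pi * J)"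
    unfolding Hm[abs_def] .
  have "g \<in> borel_measurable borel" by (rule borel_measurable_continuous_onI[OF g])
  hence m: "(\<lambda>z. g \<bar>Re z\<bar>) \<in> borel_measurable borel"
    by measurable
  show ?thesis
    unfolding circle_def J[symmetric] by (rule has_bochner_integral_distr[OF m _ hb]) simp
qed

text \<open>Integration of a parameter derivative and exchange of the two integrals.\<close>

lemma integral_eq_TI:
  fixes k K :: "real \<Rightarrow> real \<Rightarrow> real"
  assumes c: "0 \<le> c"
    and deriv: "\<And>u \<phi>. u \<in> {0..c} \<Longrightarrow> \<phi> \<in> {0..pi / 2} \<Longrightarrow> ((\<lambda>u. k u \<phi>) has_real_derivative K u \<phi>) (at u)"
    and cont: "continuous_on ({0..c} \<times> {0..pi / 2}) (\<lambda>(u, \<phi>). K u \<phi>)"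
    and init: "\<And>\<phi>. k 0 \<phi> = 0"
    and inner: "\<And>u. u \<in> {0..c} \<Longrightarrow> integral {0..pi / 2} (K u) = a * arctan_quot u"
  shows "integral {0..pi / 2} (k c) = a * TI c"
proof -
  have "integral {0..pi / 2} (k c) = integral {0..pi / 2} (\<lambda>\<phi>. integral {0..c} (\<lambda>u. K u \<phi>))"
  proof (rule integral_cong)
    fix \<phi> assume \<phi>: "\<phi> \<in> {0..pi / 2}"
    have "((\<lambda>u. K u \<phi>) has_integral (k c \<phi> - k 0 \<phi>)) {0..c}"
      by (rule fundamental_theorem_of_calculus[OF c])
         (use deriv \<phi> in \<open>auto intro: has_field_derivative_at_within
           simp flip: has_real_derivative_iff_has_vector_derivative\<close>)
    thus "k c \<phi> = integral {0..c} (\<lambda>u. K u \<phi>)" by (simp add: init integral_unique)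
  qed
  also have "\<dots> = integral {0..c} (\<lambda>u. integral {0..pi / 2} (K u))"
    using integral_swap_continuous[of 0 0 c "pi / 2" K] cont by (simp add: cbox_Pair_eq)
  also have "\<dots> = integral {0..c} (\<lambda>u. a * arctan_quot u)"
    by (rule integral_cong) (rule inner)
  finally show ?thesis by (simp add: TI_eq)
qed

lemma one_plus_sq_pos:
  fixes u x :: real
  assumes "0 \<le> u" "0 \<le> x"
  shows "0 < 1 + u\<^sup>2 + 2 * u * x"
  using assms by (simp add: add_pos_nonneg)

text \<open>The argument of the logarithm is |1 + c e^(i \<phi>)|^2. By the Cauchy-Riemann
  equations, the u-derivative of 2 ln |1 + u e^(i \<phi>)| is 2 / u times the \<phi>-derivative of
  the argument of 1 + u e^(i \<phi>), so the inner integral is elementary.\<close>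

lemma integral_ln_quadratic_cos:
  assumes "0 \<le> c"
  shows "integral {0..pi / 2} (\<lambda>\<phi>. ln (1 + c\<^sup>2 + 2 * c * cos \<phi>)) = 2 * TI c"
proof (rule integral_eq_TI[where K="\<lambda>u \<phi>. (2 * u + 2 * cos \<phi>) / (1 + u\<^sup>2 + 2 * u * cos \<phi>)", OF assms])
  fix u \<phi> :: real assume u: "u \<in> {0..c}" and \<phi>: "\<phi> \<in> {0..pi / 2}"
  have "0 < 1 + u\<^sup>2 + 2 * u * cos \<phi>" using u \<phi> by (intro one_plus_sq_pos cos_ge_zero) auto
  thus "((\<lambda>u. ln (1 + u\<^sup>2 + 2 * u * cos \<phi>)) has_real_derivative
      (2 * u + 2 * cos \<phi>) / (1 + u\<^sup>2 + 2 * u * cos \<phi>)) (at u)"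
    by (auto intro!: derivative_eq_intros simp: field_simps)
next
  have "1 + u\<^sup>2 + 2 * u * cos \<phi> \<noteq> 0" if "u \<in> {0..c}" "\<phi> \<in> {0..pi / 2}" for u \<phi>
    using one_plus_sq_pos[of u "cos \<phi>"] cos_ge_zero[of \<phi>] that by force
  thus "continuous_on ({0..c} \<times> {0..pi / 2}) (\<lambda>(u, \<phi>). (2 * u + 2 * cos \<phi>) / (1 + u\<^sup>2 + 2 * u * cos \<phi>))"
    unfolding split_beta by (intro continuous_intros) auto
next
  fix u assume u: "u \<in> {0..c}"
  show "integral {0..pi / 2} (\<lambda>\<phi>. (2 * u + 2 * cos \<phi>) / (1 + u\<^sup>2 + 2 * u * cos \<phi>)) = 2 * arctan_quot u"
  proof (cases "u = 0")
    case True
    have "((\<lambda>\<phi>. 2 * cos \<phi>) has_integral (2 * sin (pi / 2) - 2 * sin 0)) {0..pi / 2}"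
      by (rule fundamental_theorem_of_calculus)
         (auto intro!: derivative_eq_intros simp flip: has_real_derivative_iff_has_vector_derivative)
    thus ?thesis using True by (simp add: arctan_quot_def integral_unique)
  next
    case False
    \<comment> \<open>The antiderivative is 2 / u times the argument of 1 + u e^(i \<phi>), whose
      real part is positive on this range. It runs from 0 at \<phi> = 0 to arctan u at \<phi> = pi /
      2.\<close>
    have "((\<lambda>\<phi>. (2 * u + 2 * cos \<phi>) / (1 + u\<^sup>2 + 2 * u * cos \<phi>)) has_integral
        2 / u * arctan (u * sin (pi / 2) / (1 + u * cos (pi / 2))) - 2 / u * arctan (u * sin 0 / (1 + u * cos 0))) {0..pi / 2}"
    proof (rule fundamental_theorem_of_calculus)
      fix \<phi> :: real assume \<phi>: "\<phi> \<in> {0..pi / 2}"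
      have w: "0 < 1 + u * cos \<phi>" using u \<phi> by (intro add_pos_nonneg mult_nonneg_nonneg cos_ge_zero) auto
      have q: "0 < 1 + u\<^sup>2 + 2 * u * cos \<phi>" using u \<phi> by (intro one_plus_sq_pos cos_ge_zero) auto
      have s: "(1 + u * cos \<phi>)\<^sup>2 + (u * sin \<phi>)\<^sup>2 = 1 + u\<^sup>2 + 2 * u * cos \<phi>"
        using sin_cos_squared_add[of \<phi>] by algebra
      have d: "((\<lambda>\<phi>. 2 / u * arctan (u * sin \<phi> / (1 + u * cos \<phi>))) has_real_derivative
          2 / u * ((u * cos \<phi> * (1 + u * cos \<phi>) - u * sin \<phi> * (- (u * sin \<phi>))) / ((1 + u * cos \<phi>) * (1 + u * cos \<phi>))
            / (1 + (u * sin \<phi> / (1 + u * cos \<phi>))\<^sup>2))) (at \<phi>)"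
      proof -
        have "((\<lambda>\<phi>. u * sin \<phi>) has_real_derivative u * cos \<phi>) (at \<phi>)"
          and "((\<lambda>\<phi>. 1 + u * cos \<phi>) has_real_derivative - (u * sin \<phi>)) (at \<phi>)"
          by (auto intro!: derivative_eq_intros)
        from DERIV_cmult[OF DERIV_chain2[OF DERIV_arctan DERIV_divide[OF this]], of "2 / u"] w
        show ?thesis by (simp add: divide_inverse mult_ac)
      qed
      have "u * cos \<phi> * (1 + u * cos \<phi>) - u * sin \<phi> * (- (u * sin \<phi>)) = u * (u + cos \<phi>)"
        using sin_cos_squared_add[of \<phi>] by algebra
      moreover have "1 + (u * sin \<phi> / (1 + u * cos \<phi>))\<^sup>2 = (1 + u\<^sup>2 + 2 * u * cos \<phi>) / (1 + u * cos \<phi>)\<^sup>2"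
        using w by (simp flip: s add: power_divide add_divide_distrib)
      ultimately have e: "2 / u * ((u * cos \<phi> * (1 + u * cos \<phi>) - u * sin \<phi> * (- (u * sin \<phi>))) / ((1 + u * cos \<phi>) * (1 + u * cos \<phi>))
            / (1 + (u * sin \<phi> / (1 + u * cos \<phi>))\<^sup>2)) = (2 * u + 2 * cos \<phi>) / (1 + u\<^sup>2 + 2 * u * cos \<phi>)"
        using w q False by (simp add: power2_eq_square divide_simps)
      from d[unfolded e] show "((\<lambda>\<phi>. 2 / u * arctan (u * sin \<phi> / (1 + u * cos \<phi>))) has_vector_derivative
          (2 * u + 2 * cos \<phi>) / (1 + u\<^sup>2 + 2 * u * cos \<phi>)) (at \<phi> within {0..pi / 2})"
        unfolding has_real_derivative_iff_has_vector_derivative by (rule has_vector_derivative_at_within)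
    qed simp
    thus ?thesis using False by (simp add: arctan_quot_def integral_unique)
  qed
qed simp

lemma integral_arsinh_cos:
  assumes "0 \<le> c"
  shows "integral {0..pi / 2} (\<lambda>\<phi>. arsinh (c * cos \<phi>)) = TI c"
proof -
  have pos: "0 < 1 + u\<^sup>2 * (cos \<phi>)\<^sup>2" for u \<phi> :: real
    by (simp add: add_pos_nonneg)
  have "integral {0..pi / 2} (\<lambda>\<phi>. arsinh (c * cos \<phi>)) = 1 * TI c"
  proof (rule integral_eq_TI[where K="\<lambda>u \<phi>. cos \<phi> / sqrt (1 + u\<^sup>2 * (cos \<phi>)\<^sup>2)", OF assms])
    fix u \<phi> :: real
    show "((\<lambda>u. arsinh (u * cos \<phi>)) has_real_derivative cos \<phi> / sqrt (1 + u\<^sup>2 * (cos \<phi>)\<^sup>2)) (at u)"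
    proof -
      have "((\<lambda>u. u * cos \<phi>) has_real_derivative cos \<phi>) (at u)"
        by (auto intro!: derivative_eq_intros)
      from DERIV_chain2[where f=arsinh, OF arsinh_real_has_field_derivative this] show ?thesis
        by (simp add: power_mult_distrib add.commute)
    qed
  next
    show "continuous_on ({0..c} \<times> {0..pi / 2}) (\<lambda>(u, \<phi>). cos \<phi> / sqrt (1 + u\<^sup>2 * (cos \<phi>)\<^sup>2))"
    proof -
      have "1 + u\<^sup>2 * (cos \<phi>)\<^sup>2 \<noteq> 0" for u \<phi> :: real using pos[of u \<phi>] by simp
      thus ?thesis unfolding split_beta by (intro continuous_intros) auto
    qed
  next
    fix u assume u: "u \<in> {0..c}"
    show "integral {0..pi / 2} (\<lambda>\<phi>. cos \<phi> / sqrt (1 + u\<^sup>2 * (cos \<phi>)\<^sup>2)) = 1 * arctan_quot u"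
    proof (cases "u = 0")
      case True
      have "(cos has_integral (sin (pi / 2) - sin 0)) {0..pi / 2}"
        by (rule fundamental_theorem_of_calculus)
           (auto intro!: derivative_eq_intros simp flip: has_real_derivative_iff_has_vector_derivative)
      thus ?thesis using True by (simp add: arctan_quot_def integral_unique)
    next
      case False
      \<comment> \<open>The substitution s = sin \<phi> leads to (1 / u) arcsin (u s / sqrt (1 +
        u^2)); written with arctan, this is the antiderivative used here, and its value at \<phi> =
        pi / 2 is arctan u / u at once.\<close>
      have "((\<lambda>\<phi>. cos \<phi> / sqrt (1 + u\<^sup>2 * (cos \<phi>)\<^sup>2)) has_integral
          1 / u * arctan (u * sin (pi / 2) / sqrt (1 + u\<^sup>2 * (cos (pi / 2))\<^sup>2)) -
          1 / u * arctan (u * sin 0 / sqrt (1 + u\<^sup>2 * (cos 0)\<^sup>2))) {0..pi / 2}"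
      proof (rule fundamental_theorem_of_calculus)
        fix \<phi> :: real
        define D where "D = sqrt (1 + u\<^sup>2 * (cos \<phi>)\<^sup>2)"
        have D: "0 < D" "D\<^sup>2 = 1 + u\<^sup>2 * (cos \<phi>)\<^sup>2" using pos[of u \<phi>] by (simp_all add: D_def)
        have u1: "0 < 1 + u\<^sup>2" by (simp add: add_pos_nonneg)
        have d: "((\<lambda>\<phi>. 1 / u * arctan (u * sin \<phi> / sqrt (1 + u\<^sup>2 * (cos \<phi>)\<^sup>2))) has_real_derivative
          1 / u * ((u * cos \<phi> * D - u * sin \<phi> * (- (u\<^sup>2 * cos \<phi> * sin \<phi>) / D)) / (D * D)
            / (1 + (u * sin \<phi> / D)\<^sup>2))) (at \<phi>)"
        proof -
          have "((\<lambda>\<phi>. u * sin \<phi>) has_real_derivative u * cos \<phi>) (at \<phi>)"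
            and "((\<lambda>\<phi>. sqrt (1 + u\<^sup>2 * (cos \<phi>)\<^sup>2)) has_real_derivative - (u\<^sup>2 * cos \<phi> * sin \<phi>) / D) (at \<phi>)"
            using pos[of u \<phi>] by (auto intro!: derivative_eq_intros simp: D_def field_simps)
          from DERIV_cmult[OF DERIV_chain2[OF DERIV_arctan DERIV_divide[OF this]], of "1 / u"] D(1)
          show ?thesis by (simp add: divide_inverse mult_ac flip: D_def)
        qed
        have "u * cos \<phi> * D - u * sin \<phi> * (- (u\<^sup>2 * cos \<phi> * sin \<phi>) / D) = u * cos \<phi> * (D\<^sup>2 + u\<^sup>2 * (sin \<phi>)\<^sup>2) / D"
          using D(1) by (simp add: field_simps power2_eq_square)
        also have "D\<^sup>2 + u\<^sup>2 * (sin \<phi>)\<^sup>2 = 1 + u\<^sup>2"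
          unfolding D(2) using sin_cos_squared_add[of \<phi>] by algebra
        finally have n: "u * cos \<phi> * D - u * sin \<phi> * (- (u\<^sup>2 * cos \<phi> * sin \<phi>) / D) = u * cos \<phi> * (1 + u\<^sup>2) / D" .
        have "1 + (u * sin \<phi> / D)\<^sup>2 = (D\<^sup>2 + u\<^sup>2 * (sin \<phi>)\<^sup>2) / D\<^sup>2"
          using D(1) by (simp add: field_simps)
        also have "D\<^sup>2 + u\<^sup>2 * (sin \<phi>)\<^sup>2 = 1 + u\<^sup>2"
          unfolding D(2) using sin_cos_squared_add[of \<phi>] by algebra
        finally have m: "1 + (u * sin \<phi> / D)\<^sup>2 = (1 + u\<^sup>2) / D\<^sup>2" .
        have e: "1 / u * ((u * cos \<phi> * D - u * sin \<phi> * (- (u\<^sup>2 * cos \<phi> * sin \<phi>) / D)) / (D * D)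
            / (1 + (u * sin \<phi> / D)\<^sup>2)) = cos \<phi> / D"
          unfolding n m using D(1) u1 False by (simp add: power2_eq_square)
        from d[unfolded e] show "((\<lambda>\<phi>. 1 / u * arctan (u * sin \<phi> / sqrt (1 + u\<^sup>2 * (cos \<phi>)\<^sup>2))) has_vector_derivative
            cos \<phi> / sqrt (1 + u\<^sup>2 * (cos \<phi>)\<^sup>2)) (at \<phi> within {0..pi / 2})"
          unfolding D_def[symmetric]
          unfolding has_real_derivative_iff_has_vector_derivative by (rule has_vector_derivative_at_within)
      qed simp
      thus ?thesis using False by (simp add: arctan_quot_def integral_unique)
    qed
  qed simp
  thus ?thesis by simp
qed

text \<open>Integration by parts of \<open>TI (v cos \<alpha>)\<close> against \<open>d\<alpha>\<close>, followed by \<open>x = cos \<alpha>\<close>.\<close>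

lemma integral_TI_cos:
  assumes v: "0 \<le> v"
  shows "integral {0..pi / 2} (\<lambda>\<alpha>. TI (v * cos \<alpha>)) = pi / 2 * TI v - TS v 1"
proof -
  \<comment> \<open>The derivative of TI (v x) in x; away from x = 0 it is arctan (v x) / x, the
    weight in \<open>TS\<close>.\<close>
  define h where "h x = v * arctan_quot (v * x)" for x
  have ch: "continuous_on A h" for A unfolding h_def by (intro continuous_intros)
  have H: "((\<lambda>x. TI (v * x)) has_real_derivative h x) (at x within {0..1})" if "x \<in> {0..1}" for x
  proof -
    have "(TI has_real_derivative arctan_quot (v * x)) (at (v * x) within (\<lambda>x. v * x) ` {0..1})"
      by (rule has_field_derivative_subset[OF DERIV_TI[of _ v]])
         (use that v mult_left_mono[of _ 1 v] in auto)
    moreover have "((\<lambda>x. v * x) has_real_derivative v) (at x within {0..1})"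
      by (auto intro!: derivative_eq_intros)
    ultimately have "((TI \<circ> (\<lambda>x. v * x)) has_real_derivative arctan_quot (v * x) * v) (at x within {0..1})"
      by (rule DERIV_image_chain)
    thus ?thesis by (simp add: o_def h_def mult.commute[of "arctan_quot (v * x)" v])
  qed
  have cos01: "cos ` {0..pi / 2} \<subseteq> {0..1}"
    using pi_ge_zero by (auto intro!: cos_ge_zero simp del: pi_ge_zero)
  have Hc: "((\<lambda>\<alpha>. TI (v * cos \<alpha>)) has_real_derivative h (cos \<alpha>) * (- sin \<alpha>)) (at \<alpha> within {0..pi / 2})"
    if \<alpha>: "\<alpha> \<in> {0..pi / 2}" for \<alpha>
  proof -
    have "((\<lambda>x. TI (v * x)) has_real_derivative h (cos \<alpha>)) (at (cos \<alpha>) within cos ` {0..pi / 2})"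
      by (rule has_field_derivative_subset[OF H cos01]) (use cos01 \<alpha> in blast)
    moreover have "(cos has_real_derivative (- sin \<alpha>)) (at \<alpha> within {0..pi / 2})"
      by (auto intro!: derivative_eq_intros)
    ultimately show ?thesis
      using DERIV_image_chain[of "\<lambda>x. TI (v * x)" _ cos \<alpha> "{0..pi / 2}" "- sin \<alpha>"]
      by (simp add: o_def)
  qed
  \<comment> \<open>The antiderivative \<alpha> TI (v cos \<alpha>) vanishes at both ends, at pi / 2
    because TI 0 = 0.\<close>
  have "((\<lambda>\<alpha>. TI (v * cos \<alpha>) + \<alpha> * (h (cos \<alpha>) * (- sin \<alpha>))) has_integral
      (pi / 2 * TI (v * cos (pi / 2)) - 0 * TI (v * cos 0))) {0..pi / 2}"
    by (rule fundamental_theorem_of_calculus)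
       (auto intro!: derivative_eq_intros Hc simp flip: has_real_derivative_iff_has_vector_derivative)
  hence 1: "((\<lambda>\<alpha>. TI (v * cos \<alpha>) + \<alpha> * (h (cos \<alpha>) * (- sin \<alpha>))) has_integral 0) {0..pi / 2}" by simp
  define f where "f x = arccos x * h x" for x
  have cf: "continuous_on {0..1} f"
    unfolding f_def by (intro continuous_on_mult continuous_on_subset[OF continuous_on_arccos'] ch) auto
  have "((\<lambda>\<alpha>. - sin \<alpha> *\<^sub>R f (cos \<alpha>)) has_integral
      (integral {cos 0..cos (pi / 2)} f - integral {cos (pi / 2)..cos 0} f)) {0..pi / 2}"
    by (rule has_integral_substitution_general[of "{}" _ _ _ 0 1])
       (use cos01 cf in \<open>auto intro!: derivative_eq_intros continuous_intros\<close>)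
  hence "((\<lambda>\<alpha>. - sin \<alpha> * f (cos \<alpha>)) has_integral - integral {0..1} f) {0..pi / 2}" by simp
  hence 2: "((\<lambda>\<alpha>. \<alpha> * (h (cos \<alpha>) * (- sin \<alpha>))) has_integral - integral {0..1} f) {0..pi / 2}"
    by (rule has_integral_eq[rotated]) (auto simp: f_def arccos_cos)
  have "((\<lambda>\<alpha>. TI (v * cos \<alpha>)) has_integral integral {0..1} f) {0..pi / 2}"
    using has_integral_diff[OF 1 2] by simp
  hence "integral {0..pi / 2} (\<lambda>\<alpha>. TI (v * cos \<alpha>)) = integral {0..1} f" by (rule integral_unique)
  \<comment> \<open>Writing arccos as pi / 2 - arcsin separates the two terms: the constant
    integrates h to TI v, and arcsin produces TS v 1.\<close>
  also have "\<dots> = integral {0..1} (\<lambda>x. pi / 2 * h x - arcsin x * h x)"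
    by (rule integral_cong) (simp add: f_def arcsin_arccos_eq algebra_simps)
  also have "\<dots> = pi / 2 * integral {0..1} h - integral {0..1} (\<lambda>x. arcsin x * h x)"
    by (subst integral_diff)
       (auto intro!: integrable_continuous_interval continuous_intros ch continuous_on_mult
          continuous_on_subset[OF continuous_on_arcsin'])
  also have "(h has_integral (TI (v * 1) - TI (v * 0))) {0..1}"
    by (rule fundamental_theorem_of_calculus) (use H in \<open>auto simp flip: has_real_derivative_iff_has_vector_derivative\<close>)
  hence "integral {0..1} h = TI v" by (simp add: integral_unique)
  also have "integral {0..1} (\<lambda>x. arcsin x * h x) = TS v 1"
    unfolding TS_def by (rule integral_spike[of "{0}"]) (auto simp: h_def arctan_quot_def)
  finally show ?thesis .
qed

lemma circle_mean_ln_abs_Re: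
  assumes "0 \<le> c"
  shows "has_bochner_integral circle (\<lambda>z. ln (1 + c\<^sup>2 + 2 * c * \<bar>Re z\<bar>)) (4 / pi * TI c)"
proof -
  have pos: "1 + c\<^sup>2 + 2 * c * \<bar>x\<bar> \<noteq> 0" for x using one_plus_sq_pos[OF assms, of "\<bar>x\<bar>"] by simp
  have "has_bochner_integral circle (\<lambda>z. ln (1 + c\<^sup>2 + 2 * c * \<bar>\<bar>Re z\<bar>\<bar>))
    (2 / pi * integral {0..pi / 2} (\<lambda>\<phi>. ln (1 + c\<^sup>2 + 2 * c * \<bar>cos \<phi>\<bar>)))"
    by (rule circle_mean_Re) (use pos in \<open>auto intro!: continuous_intros\<close>)
  also have "integral {0..pi / 2} (\<lambda>\<phi>. ln (1 + c\<^sup>2 + 2 * c * \<bar>cos \<phi>\<bar>)) = integral {0..pi / 2} (\<lambda>\<phi>. ln (1 + c\<^sup>2 + 2 * c * cos \<phi>))"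
    by (rule integral_cong) (simp add: cos_ge_zero)
  finally show ?thesis by (simp add: integral_ln_quadratic_cos assms)
qed

lemma circle_mean_arsinh_abs_Re:
  assumes "0 \<le> c"
  shows "has_bochner_integral circle (\<lambda>z. arsinh (c * \<bar>Re z\<bar>)) (2 / pi * TI c)"
  using circle_mean_Re[of "\<lambda>x. arsinh (c * x)"] integral_arsinh_cos[OF assms]
  by (simp add: continuous_intros)

lemma circle_mean_TI:
  assumes "0 \<le> v"
  shows "has_bochner_integral circle (\<lambda>z. TI (v * \<bar>Re z\<bar>)) (TI v - 2 / pi * TS v 1)"
proof -
  have "has_bochner_integral circle (\<lambda>z. TI (v * \<bar>\<bar>Re z\<bar>\<bar>)) (2 / pi * integral {0..pi / 2} (\<lambda>\<phi>. TI (v * \<bar>cos \<phi>\<bar>)))"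
    by (rule circle_mean_Re, rule continuous_on_compose2[OF continuous_on_TI])
       (use assms in \<open>auto intro!: continuous_intros\<close>)
  also have "integral {0..pi / 2} (\<lambda>\<phi>. TI (v * \<bar>cos \<phi>\<bar>)) = integral {0..pi / 2} (\<lambda>\<phi>. TI (v * cos \<phi>))"
    by (rule integral_cong) (simp add: cos_ge_zero)
  finally show ?thesis by (simp add: integral_TI_cos assms algebra_simps)
qed

lemma circle_mean_ln_one_plus_Re:
  assumes "0 \<le> v"
  shows "has_bochner_integral circle (\<lambda>z. ln (1 + v * \<bar>Re z\<bar>)) (2 / pi * integral {0..pi / 2} (\<lambda>\<theta>. ln (1 + v * sin \<theta>)))"
proof -
  have pos: "1 + v * \<bar>x\<bar> \<noteq> 0" for x using mult_nonneg_nonneg[OF assms, of "\<bar>x\<bar>"] by linarith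
  have "has_bochner_integral circle (\<lambda>z. ln (1 + v * \<bar>\<bar>Re z\<bar>\<bar>)) (2 / pi * integral {0..pi / 2} (\<lambda>\<phi>. ln (1 + v * \<bar>cos \<phi>\<bar>)))"
    by (rule circle_mean_Re) (use pos in \<open>auto intro!: continuous_intros\<close>)
  \<comment> \<open>The reflection of \<phi> about pi / 4 trades the cosine for the sine in which
    the fifth identity is stated.\<close>
  also have "integral {0..pi / 2} (\<lambda>\<phi>. ln (1 + v * \<bar>cos \<phi>\<bar>)) = integral {0..pi / 2} (\<lambda>\<phi>. ln (1 + v * sin (- \<phi> + pi / 2)))"
    by (rule integral_cong) (simp add: cos_ge_zero sin_cos_eq)
  also have "\<dots> = integral {- (pi / 2)..0} (\<lambda>\<phi>. ln (1 + v * sin (\<phi> + pi / 2)))"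
    using Henstock_Kurzweil_Integration.integral_reflect_real[where a="- (pi / 2)" and b=0 and f="\<lambda>\<phi>. ln (1 + v * sin (\<phi> + pi / 2))"] by simp
  also have "\<dots> = integral {0..pi / 2} (\<lambda>\<theta>. ln (1 + v * sin \<theta>))"
  proof -
    have "1 + v * sin \<theta> \<noteq> 0" if "\<theta> \<in> {0..pi / 2}" for \<theta>
      using mult_nonneg_nonneg[OF assms, of "sin \<theta>"] sin_ge_zero[of \<theta>] that by force
    hence "continuous_on {- (pi / 2) + pi / 2..0 + pi / 2} (\<lambda>\<theta>. ln (1 + v * sin \<theta>))"
      by (intro continuous_intros) auto
    from integral_shift[OF this] show ?thesis by (simp add: o_def)
  qed
  finally show ?thesis by simp
qed

section \<open>The Mahler measure as an iterated average\<close>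

lemma borel_measurable_leval:
  assumes "\<And>i. (\<lambda>x. w x i) \<in> borel_measurable M"
  shows "(\<lambda>x. leval P (w x)) \<in> borel_measurable M"
proof -
  have "(\<lambda>x. w x i powi n) \<in> borel_measurable M" for i n
    using assms[of i] unfolding power_int_def by (cases "n \<ge> 0") simp_all
  thus ?thesis
    unfolding leval_def by measurable
qed

lemma norm_leval_le:
  assumes "\<And>i. cmod (w i) = 1"
  shows "cmod (leval P w) \<le> (\<Sum>e\<in>Poly_Mapping.keys P. cmod (Poly_Mapping.lookup P e))"
  unfolding leval_def
  by (rule order.trans[OF norm_sum]) (simp add: norm_mult prod_norm[symmetric] norm_power_int assms)

text \<open>The maximum with 0 covers z = 0, where the convention ln 0 = 0 can exceed
  \<open>ln B\<close>.\<close>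

lemma ln_norm_le:
  assumes "cmod z \<le> B"
  shows "ln (cmod z) \<le> max 0 (ln B)"
  using assms by (cases "z = 0") (auto simp: le_max_iff_disj intro: ln_mono)

lemma AE_torus:
  assumes "{p. P p} \<in> sets (borel \<Otimes>\<^sub>M borel)"
    and "\<And>a b. cmod a = 1 \<Longrightarrow> cmod b = 1 \<Longrightarrow> P (a, b)"
  shows "AE p in circle \<Otimes>\<^sub>M circle. P p"
proof (rule circle2.AE_pair_measure)
  show "AE x in circle. AE y in circle. P (x, y)"
    by (rule AE_mp[OF AE_circle_norm AE_I2], rule impI, rule AE_mp[OF AE_circle_norm AE_I2])
       (use assms in auto)
qed (use assms in \<open>simp_all add: space_pair_measure\<close>)

lemma AE_torus_norm: "AE p in circle \<Otimes>\<^sub>M circle. cmod (fst p) = 1 \<and> cmod (snd p) = 1"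
proof (rule AE_torus)
  have "{p \<in> space (borel \<Otimes>\<^sub>M borel). cmod (fst p) = 1 \<and> cmod (snd p) = 1} \<in> sets (borel \<Otimes>\<^sub>M borel)"
    by measurable
  thus "{p. cmod (fst p) = 1 \<and> cmod (snd p) = 1} \<in> sets (borel \<Otimes>\<^sub>M borel)"
    by (simp add: space_pair_measure)
qed auto

text \<open>The interface to all five identities: k is the variable averaged first, \<open>L\<close>
  the polynomial rewritten on the torus, and \<open>g\<close> its inner average. Integrability on
  the three-torus comes out as a result, since the sum of the moduli of the coefficients bounds P,
  and hence \<open>ln (cmod P)\<close>, from above.\<close>

lemma mahler_iterated:
  assumes dist: "distinct [i, j, k]" and vars: "lvars P \<subseteq> {i, j, k}"
    and eq: "\<And>a b c. cmod a = 1 \<Longrightarrow> cmod b = 1 \<Longrightarrow> cmod c = 1 \<Longrightarrow>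
      leval P ((\<lambda>_. c)(i := a, j := b)) = L a b c"
    and inner: "AE p in circle \<Otimes>\<^sub>M circle. has_bochner_integral circle (\<lambda>c. ln (cmod (L (fst p) (snd p) c))) (g p)"
    and outer: "has_bochner_integral (circle \<Otimes>\<^sub>M circle) g m"
  shows "mahler P = m"
proof (rule mahler_eqI[OF dist vars])
  define f where "f = (\<lambda>((a, b), c). ln (cmod (leval P ((\<lambda>_. c)(i := a, j := b)))))"
  define B where "B = (\<Sum>e\<in>Poly_Mapping.keys P. cmod (Poly_Mapping.lookup P e))"
  have m: "f \<in> borel_measurable ((circle \<Otimes>\<^sub>M circle) \<Otimes>\<^sub>M circle)"
    unfolding f_def split_beta'
    by (intro borel_measurable_ln measurable_compose[OF _ borel_measurable_norm] borel_measurable_leval)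
       (auto simp: fun_upd_def)
  have "has_bochner_integral ((circle \<Otimes>\<^sub>M circle) \<Otimes>\<^sub>M circle) f m"
  proof (rule has_bochner_integral_pairI[OF _ _ m _ _ outer])
    show "AE p in circle \<Otimes>\<^sub>M circle. AE c in circle. f (p, c) \<le> max 0 (ln B)"
    proof (rule AE_mp[OF AE_torus_norm AE_I2], rule impI, rule AE_mp[OF AE_circle_norm AE_I2], rule impI)
      fix p :: "complex \<times> complex" and c :: complex
      assume "cmod (fst p) = 1 \<and> cmod (snd p) = 1" "cmod c = 1"
      thus "f (p, c) \<le> max 0 (ln B)"
        unfolding f_def B_def split_beta
        by (intro ln_norm_le) (auto intro!: norm_leval_le)
    qed
    show "AE p in circle \<Otimes>\<^sub>M circle. has_bochner_integral circle (\<lambda>c. f (p, c)) (g p)"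
    proof (rule AE_mp[OF AE_torus_norm], rule AE_mp[OF inner AE_I2], intro impI)
      fix p assume p: "cmod (fst p) = 1 \<and> cmod (snd p) = 1"
        and hb: "has_bochner_integral circle (\<lambda>c. ln (cmod (L (fst p) (snd p) c))) (g p)"
      show "has_bochner_integral circle (\<lambda>c. f (p, c)) (g p)"
      proof (rule has_bochner_integral_circle_AE_cong[OF hb])
        show "AE c in circle. ln (cmod (L (fst p) (snd p) c)) = f (p, c)"
          by (rule AE_mp[OF AE_circle_norm AE_I2]) (use p in \<open>auto simp: f_def split_beta eq\<close>)
        show "(\<lambda>c. f (p, c)) \<in> borel_measurable borel"
          using measurable_compose[OF measurable_Pair1' m, of p] by (simp add: space_pair_measure)
      qed
    qed
  qed (rule circle2.prob_space_axioms circle.prob_space_axioms)+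
  thus "has_bochner_integral ((circle \<Otimes>\<^sub>M circle) \<Otimes>\<^sub>M circle)
      (\<lambda>((a, b), c). ln (cmod (leval P ((\<lambda>_. c)(i := a, j := b))))) m"
    unfolding f_def .
qed

lemma has_bochner_integral_torusI:
  fixes f :: "complex \<times> complex \<Rightarrow> real"
  assumes m: "f \<in> borel_measurable (borel \<Otimes>\<^sub>M borel)"
    and bdd: "\<And>a b. cmod a = 1 \<Longrightarrow> cmod b = 1 \<Longrightarrow> f (a, b) \<le> B"
    and inner: "\<And>a. cmod a = 1 \<Longrightarrow> has_bochner_integral circle (\<lambda>b. f (a, b)) (g a)"
    and outer: "has_bochner_integral circle g c"
  shows "has_bochner_integral (circle \<Otimes>\<^sub>M circle) f c"
proof (rule has_bochner_integral_pairI[OF circle.prob_space_axioms circle.prob_space_axioms _ _ _ outer])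
  show "AE x in circle. AE y in circle. f (x, y) \<le> B"
    by (rule AE_mp[OF AE_circle_norm AE_I2], rule impI, rule AE_mp[OF AE_circle_norm AE_I2])
       (use bdd in auto)
  show "AE x in circle. has_bochner_integral circle (\<lambda>y. f (x, y)) (g x)"
    by (rule AE_mp[OF AE_circle_norm AE_I2]) (use inner in auto)
qed (use m in simp)

lemma has_bochner_integral_circle_norm_cong:
  fixes f g :: "complex \<Rightarrow> real"
  assumes "has_bochner_integral circle f c" "\<And>z. cmod z = 1 \<Longrightarrow> f z = g z" "g \<in> borel_measurable borel"
  shows "has_bochner_integral circle g c"
  by (rule has_bochner_integral_circle_AE_cong[OF assms(1) _ assms(3)])
     (rule AE_mp[OF AE_circle_norm AE_I2], use assms(2) in auto)

lemma has_bochner_integral_circle_const: "has_bochner_integral circle (\<lambda>_. c) (c::real)"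
  by (simp add: has_bochner_integral_iff)

section \<open>Coordinates on the circle and the first identity\<close>

lemma inverse_eq_cnj: "cmod z = 1 \<Longrightarrow> inverse z = cnj z"
  using complex_norm_square[of z] by (intro inverse_unique) simp

lemma circle_Re_Im:
  assumes "cmod z = 1"
  shows "z + inverse z = of_real (2 * Re z)" "z - inverse z = of_real (2 * Im z) * \<i>"
    "(Re z)\<^sup>2 + (Im z)\<^sup>2 = 1" "\<bar>Re z\<bar> \<le> 1" "\<bar>Im z\<bar> \<le> 1"
  using assms abs_Re_le_cmod[of z] abs_Im_le_cmod[of z]
  by (auto simp: inverse_eq_cnj complex_eq_iff cmod_power2[symmetric])

text \<open>The phase of s is absorbed into z by a rotation, so only |s| matters.\<close>

lemma circle_mean_ln_abs_Re_mult:
  "has_bochner_integral circle (\<lambda>z. ln (1 + (cmod s)\<^sup>2 + 2 * \<bar>Re (s * z)\<bar>)) (4 / pi * TI (cmod s))"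
proof -
  define u where "u = (if s = 0 then 1 else s / of_real (cmod s))"
  have u: "cmod u = 1" "s = of_real (cmod s) * u" by (auto simp: u_def norm_divide)
  have "Re (s * z) = cmod s * Re (u * z)" for z
    by (subst u(2)) (simp add: mult.assoc)
  hence "\<bar>Re (s * z)\<bar> = cmod s * \<bar>Re (u * z)\<bar>" for z
    by (simp add: abs_mult)
  moreover have "has_bochner_integral circle (\<lambda>z. ln (1 + (cmod s)\<^sup>2 + 2 * cmod s * \<bar>Re (u * z)\<bar>)) (4 / pi * TI (cmod s))"
    by (rule has_bochner_integral_circle_rotate[OF u(1) circle_mean_ln_abs_Re[OF norm_ge_zero]])
  ultimately show ?thesis by (simp add: mult.assoc)
qed

text \<open>\<open>TI\<close> is 0 on negative arguments, hence equal to its composition with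
  \<open>max 0\<close>, and continuity on the half-line suffices.\<close>

lemma borel_measurable_TI [measurable]: "TI \<in> borel_measurable borel"
proof -
  have "(\<lambda>x. TI (max 0 x)) \<in> borel_measurable borel"
    by (rule borel_measurable_continuous_onI, rule continuous_on_compose2[OF continuous_on_TI])
       (auto intro!: continuous_intros)
  moreover have "TI (max 0 x) = TI x" for x by (auto simp: max_def TI_def)
  ultimately show ?thesis by simp
qed

text \<open>For w = z^2 on the circle, 1 + z^2 = z (z + 1 / z) has modulus 2 |Re z|. Since squaring
  preserves the measure, the mean over w is the mean of TI (v |Re z|) over z.\<close>

lemma circle_mean_TI_norm:
  assumes "0 \<le> v"
  shows "has_bochner_integral circle (\<lambda>w. TI (cmod (of_real (v / 2) * (1 + w)))) (TI v - 2 / pi * TS v 1)"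
proof -
  have "has_bochner_integral circle (\<lambda>z. TI (cmod (of_real (v / 2) * (1 + z\<^sup>2)))) (TI v - 2 / pi * TS v 1)"
  proof (rule has_bochner_integral_circle_norm_cong[OF circle_mean_TI[OF assms]])
    fix z assume z: "cmod z = 1"
    hence "z \<noteq> 0" by auto
    hence "1 + z\<^sup>2 = z * (z + inverse z)" by (simp add: algebra_simps power2_eq_square)
    hence "cmod (1 + z\<^sup>2) = 2 * \<bar>Re z\<bar>"
      using z unfolding circle_Re_Im(1)[OF z] by (simp only: norm_mult norm_of_real)
    thus "TI (v * \<bar>Re z\<bar>) = TI (cmod (of_real (v / 2) * (1 + z\<^sup>2)))"
      using assms by (simp add: norm_mult)
  qed measurable
  hence "has_bochner_integral (distr circle circle (\<lambda>z. z\<^sup>2)) (\<lambda>w. TI (cmod (of_real (v / 2) * (1 + w)))) (TI v - 2 / pi * TS v 1)"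
    by (intro has_bochner_integral_distr) measurable
  thus ?thesis by (simp only: distr_circle_square)
qed

lemma has_bochner_integral_torus_shear:
  fixes g :: "complex \<times> complex \<Rightarrow> real"
  assumes "g \<in> borel_measurable (borel \<Otimes>\<^sub>M borel)"
    and "has_bochner_integral (circle \<Otimes>\<^sub>M circle) (\<lambda>(w, y). g (y * w, y)) c"
  shows "has_bochner_integral (circle \<Otimes>\<^sub>M circle) g c"
proof -
  have "has_bochner_integral (distr (circle \<Otimes>\<^sub>M circle) (circle \<Otimes>\<^sub>M circle) (\<lambda>(w, y). (y * w, y))) g c"
    by (rule has_bochner_integral_distr) (use assms in \<open>simp_all add: split_beta'\<close>)
  thus ?thesis by (simp only: distr_torus_shear)
qed

text \<open>The squares of the two moduli are 1 + |q|^2 + 2 Re q and 1 + |q|^2 - 2 Re q, so the sign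
  of Re q decides which one is larger.\<close>

lemma max_norm_one_plus_minus:
  "ln (max (cmod (1 + q)) (cmod (1 - q))) = ln (1 + (cmod q)\<^sup>2 + 2 * \<bar>Re q\<bar>) / 2"
proof -
  have p: "(cmod (1 + q))\<^sup>2 = 1 + (cmod q)\<^sup>2 + 2 * Re q" and m: "(cmod (1 - q))\<^sup>2 = 1 + (cmod q)\<^sup>2 - 2 * Re q"
    unfolding cmod_power2 by (auto simp: power2_eq_square algebra_simps)
  have "(max (cmod (1 + q)) (cmod (1 - q)))\<^sup>2 = 1 + (cmod q)\<^sup>2 + 2 * \<bar>Re q\<bar>"
  proof (cases "0 \<le> Re q")
    case True
    hence "(cmod (1 - q))\<^sup>2 \<le> (cmod (1 + q))\<^sup>2" unfolding p m by simp
    hence "cmod (1 - q) \<le> cmod (1 + q)" by simp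
    thus ?thesis using True p by (simp add: max_absorb1)
  next
    case False
    hence "(cmod (1 + q))\<^sup>2 \<le> (cmod (1 - q))\<^sup>2" unfolding p m by simp
    hence "cmod (1 + q) \<le> cmod (1 - q)" by simp
    thus ?thesis using False m by (simp add: max_absorb2)
  qed
  hence "ln (1 + (cmod q)\<^sup>2 + 2 * \<bar>Re q\<bar>) = ln ((max (cmod (1 + q)) (cmod (1 - q)))\<^sup>2)" by simp
  thus ?thesis by (simp add: ln_realpow)
qed

text \<open>As a polynomial in x the coefficients are 1 + q and 1 - q with q = (v / 2) (y + z). The
  shear z = y w turns q into s y with s = (v / 2) (1 + w): the average over y then only rotates s
  and leaves a multiple of TI |s|, and the average over w remains.\<close>

lemma mahler_identity_1:
  fixes v :: real
  assumes v: "0 \<le> v"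
  shows "mahler (1 + X + lconst (v / 2) * (1 - X) * (Y + Z)) = 2 / pi * TI v - 4 / pi\<^sup>2 * TS v 1"
proof -
  define q where "q p = of_real (v / 2) * (snd p + fst p)" for p :: "complex \<times> complex"
  define g where "g p = ln (max (cmod (1 + q p)) (cmod (1 - q p)))" for p
  have nz: "1 + z \<noteq> 0 \<or> 1 - z \<noteq> 0" for z :: complex by (auto simp: complex_eq_iff)
  have gm: "g \<in> borel_measurable (borel \<Otimes>\<^sub>M borel)" unfolding g_def q_def by measurable
  show ?thesis
  proof (rule mahler_iterated[where i=2 and j=1 and k=0 and g=g
      and L="\<lambda>a b c. (1 + q (a, b)) + (1 - q (a, b)) * c"])
    show "lvars (1 + X + lconst (v / 2) * (1 - X) * (Y + Z)) \<subseteq> {2, 1, 0}"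
      by (intro lvars_subset_intros) auto
    show "leval (1 + X + lconst (v / 2) * (1 - X) * (Y + Z)) ((\<lambda>_. c)(2 := a, 1 := b)) = (1 + q (a, b)) + (1 - q (a, b)) * c"
      if "cmod a = 1" "cmod b = 1" "cmod c = 1" for a b c
    proof -
      have "((\<lambda>_. c)(2 := a, 1 := b)) i \<noteq> 0" for i :: nat using that by auto
      thus ?thesis by (simp add: leval_add leval_mult leval_diff q_def field_simps)
    qed
    show "AE p in circle \<Otimes>\<^sub>M circle. has_bochner_integral circle
        (\<lambda>c. ln (cmod (1 + q (fst p, snd p) + (1 - q (fst p, snd p)) * c))) (g p)"
      using circle_mean_ln_linear[OF nz] by (intro AE_I2) (simp add: g_def)
    show "has_bochner_integral (circle \<Otimes>\<^sub>M circle) g (2 / pi * TI v - 4 / pi\<^sup>2 * TS v 1)"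
    proof (rule has_bochner_integral_torus_shear[OF gm], rule has_bochner_integral_torusI)
      show "(\<lambda>(w, y). g (y * w, y)) \<in> borel_measurable (borel \<Otimes>\<^sub>M borel)"
        unfolding g_def q_def by measurable
      show "(case (w, y) of (w, y) \<Rightarrow> g (y * w, y)) \<le> max 0 (ln (1 + v))" if "cmod w = 1" "cmod y = 1" for w y
      proof -
        have "cmod (q (y * w, y)) \<le> (v / 2) * (1 + 1)"
          unfolding q_def norm_mult using v that norm_triangle_ineq[of y "y * w"]
          by (intro mult_mono) (auto simp: norm_mult)
        hence "cmod (1 + q (y * w, y)) \<le> 1 + v" "cmod (1 - q (y * w, y)) \<le> 1 + v"
          using norm_triangle_ineq[of 1 "q (y * w, y)"] norm_triangle_ineq4[of 1 "q (y * w, y)"] by auto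
        thus ?thesis
          using ln_norm_le[of "1 + q (y * w, y)" "1 + v"] ln_norm_le[of "1 - q (y * w, y)" "1 + v"]
          by (simp add: g_def max_def[of "cmod (1 + q (y * w, y))"])
      qed
      show "has_bochner_integral circle (\<lambda>y. case (w, y) of (w, y) \<Rightarrow> g (y * w, y))
          (4 / pi * TI (cmod (of_real (v / 2) * (1 + w))) / 2)" if "cmod w = 1" for w
      proof (rule has_bochner_integral_circle_norm_cong)
        let ?s = "of_real (v / 2) * (1 + w)"
        show "has_bochner_integral circle (\<lambda>y. ln (1 + (cmod ?s)\<^sup>2 + 2 * \<bar>Re (?s * y)\<bar>) / 2) (4 / pi * TI (cmod ?s) / 2)"
          by (intro has_bochner_integral_divide_zero circle_mean_ln_abs_Re_mult)
        show "ln (1 + (cmod ?s)\<^sup>2 + 2 * \<bar>Re (?s * y)\<bar>) / 2 = (case (w, y) of (w, y) \<Rightarrow> g (y * w, y))"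
          if "cmod y = 1" for y
        proof -
          have "q (y * w, y) = ?s * y" by (simp add: q_def algebra_simps)
          moreover have "cmod (?s * y) = cmod ?s" using that by (simp add: norm_mult)
          ultimately show ?thesis by (simp add: g_def max_norm_one_plus_minus del: of_real_divide)
        qed
      qed (simp add: g_def q_def)
      have "has_bochner_integral circle (\<lambda>w. 2 / pi * TI (cmod (of_real (v / 2) * (1 + w)))) (2 / pi * (TI v - 2 / pi * TS v 1))"
        by (intro has_bochner_integral_mult_right circle_mean_TI_norm v)
      thus "has_bochner_integral circle (\<lambda>w. 4 / pi * TI (cmod (of_real (v / 2) * (1 + w))) / 2) (2 / pi * TI v - 4 / pi\<^sup>2 * TS v 1)"
        by (simp add: algebra_simps power2_eq_square)
    qed
  qed simp
qed

section \<open>The second identity\<close>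

lemma circle_one_plus_square: "cmod a = 1 \<Longrightarrow> (1 + a)\<^sup>2 = a * of_real ((cmod (1 + a))\<^sup>2)"
  unfolding complex_norm_square using complex_norm_square[of a]
  by (simp add: algebra_simps power2_eq_square)

text \<open>On the circle (1 + a)^2 = a (1 + a) (1 + cnj a), so the polynomial is a times a positive
  real. This shows that it has no zero there and gives its modulus 1 + |s|^2 with s = (v / 2) (1 +
  a).\<close>

lemma circle_quadratic_factor:
  fixes v :: real
  assumes "cmod a = 1"
  shows "a + of_real (v\<^sup>2 / 4) * (1 + a)\<^sup>2 = a * of_real (1 + (cmod (of_real (v / 2) * (1 + a)))\<^sup>2)"
proof -
  have n: "(cmod (of_real (v / 2) * (1 + a)))\<^sup>2 = v\<^sup>2 / 4 * (cmod (1 + a))\<^sup>2"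
    by (simp only: norm_mult norm_of_real power_mult_distrib) (simp add: power_divide)
  show ?thesis
    unfolding n circle_one_plus_square[OF assms] by (simp add: algebra_simps)
qed

text \<open>Averaging the integrand over \<open>b\<close> and \<open>- b\<close> turns the maximum into a sum of two logarithms.\<close>

lemma circle_mean_ln_max:
  "has_bochner_integral circle (\<lambda>b. ln (max (1 + (cmod s)\<^sup>2) ((cmod (b + s))\<^sup>2)))
     (ln (1 + (cmod s)\<^sup>2) / 2 + 2 / pi * TI (cmod s))"
proof -
  define A where "A = 1 + (cmod s)\<^sup>2"
  have A: "1 \<le> A" by (simp add: A_def)
  define k where "k b = ln (max A ((cmod (b + s))\<^sup>2))" for b
  have [measurable]: "k \<in> borel_measurable borel" unfolding k_def by measurable
  have sq: "(cmod (b + s))\<^sup>2 = A + 2 * Re (s * cnj b)" if "cmod b = 1" for b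
    using that unfolding A_def cmod_power2 norm_eq_1 [symmetric]
    by (simp add: power2_eq_square algebra_simps cmod_def)
  \<comment> \<open>The maximum with A \<ge> 1 keeps the logarithm away from its singularity, so the
    mean I exists before it is computed.\<close>
  have "\<bar>k b\<bar> \<le> ln (max A ((1 + cmod s)\<^sup>2))" if "cmod b = 1" for b
  proof -
    have "(cmod (b + s))\<^sup>2 \<le> (1 + cmod s)\<^sup>2"
      using norm_triangle_ineq[of b s] that by (intro power_mono) auto
    hence "k b \<le> ln (max A ((1 + cmod s)\<^sup>2))"
      unfolding k_def using A by (intro ln_mono max.mono) auto
    moreover have "0 \<le> k b" unfolding k_def using A by (intro ln_ge_zero) auto
    ultimately show ?thesis by simp
  qed
  hence "integrable circle k" by (intro integrable_circle_bounded) auto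
  then obtain I where I: "has_bochner_integral circle k I" by (auto simp: has_bochner_integral_iff)
  have "has_bochner_integral circle (\<lambda>b. k b + k (- 1 * b)) (I + I)"
    by (intro has_bochner_integral_add I has_bochner_integral_circle_rotate) simp
  moreover have "has_bochner_integral circle (\<lambda>b. ln A + ln (1 + (cmod s)\<^sup>2 + 2 * \<bar>Re (s * cnj b)\<bar>))
      (ln A + 4 / pi * TI (cmod s))"
    by (intro has_bochner_integral_add has_bochner_integral_circle_const
        has_bochner_integral_circle_cnj[where f="\<lambda>b. ln (1 + (cmod s)\<^sup>2 + 2 * \<bar>Re (s * b)\<bar>)"]
        circle_mean_ln_abs_Re_mult)
  \<comment> \<open>Changing the sign of b changes the sign of r, so one of the two maxima is A and
    the other is A + 2 |r|.\<close>
  moreover have "AE b in circle. k b + k (- 1 * b) = ln A + ln (1 + (cmod s)\<^sup>2 + 2 * \<bar>Re (s * cnj b)\<bar>)"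
  proof (rule AE_mp[OF AE_circle_norm AE_I2], rule impI)
    fix b assume b: "cmod b = 1"
    define r where "r = Re (s * cnj b)"
    have r: "Re (s * cnj (- 1 * b)) = - r" by (simp add: r_def)
    have "k b = ln (max A (A + 2 * r))" unfolding k_def sq[OF b] r_def ..
    moreover have "cmod (- 1 * b) = 1" using b by simp
    hence "k (- 1 * b) = ln (max A (A - 2 * r))" unfolding k_def by (subst sq) (simp_all only: r, simp)
    ultimately show "k b + k (- 1 * b) = ln A + ln (1 + (cmod s)\<^sup>2 + 2 * \<bar>Re (s * cnj b)\<bar>)"
      unfolding r_def[symmetric] A_def[symmetric]
      by (cases "0 \<le> r") (auto simp: max_absorb1 max_absorb2)
  qed
  ultimately have "I + I = ln A + 4 / pi * TI (cmod s)"
    by (rule has_bochner_integral_circle_AE_unique)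
  hence "I = ln (1 + (cmod s)\<^sup>2) / 2 + 2 / pi * TI (cmod s)" by (simp add: A_def)
  with I show ?thesis unfolding k_def A_def by simp
qed

text \<open>This mean gets no closed form: it is the Mahler measure that stays on the right of the
  second identity. Here x is the innermost variable, and the inner average is constant in the other
  two.\<close>

lemma circle_mean_mahler_quadratic:
  fixes v :: real
  shows "has_bochner_integral circle (\<lambda>a. ln (1 + (cmod (of_real (v / 2) * (1 + a)))\<^sup>2))
    (mahler (X + lconst (v\<^sup>2 / 4) * (1 + X)\<^sup>2))"
proof -
  define k where "k a = ln (1 + (cmod (of_real (v / 2) * (1 + a)))\<^sup>2)" for a
  have km: "k \<in> borel_measurable borel" unfolding k_def by measurable
  have bound: "\<bar>k a\<bar> \<le> ln (1 + v\<^sup>2)" if "cmod a = 1" for a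
  proof -
    have "cmod (of_real (v / 2) * (1 + a)) \<le> \<bar>v\<bar> / 2 * (1 + 1)"
      unfolding norm_mult using that norm_triangle_ineq[of 1 a] by (intro mult_mono) auto
    hence "(cmod (of_real (v / 2) * (1 + a)))\<^sup>2 \<le> \<bar>v\<bar>\<^sup>2" by (intro power_mono) auto
    hence "k a \<le> ln (1 + v\<^sup>2)" unfolding k_def by (intro ln_mono) (auto intro: add_pos_nonneg)
    moreover have "0 \<le> k a" unfolding k_def by (intro ln_ge_zero) auto
    ultimately show ?thesis by simp
  qed
  have "integrable circle k" using km bound by (rule integrable_circle_bounded)
  then obtain I where I: "has_bochner_integral circle k I" by (auto simp: has_bochner_integral_iff)
  have "mahler (X + lconst (v\<^sup>2 / 4) * (1 + X)\<^sup>2) = I"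
  proof (rule mahler_iterated[where i=1 and j=2 and k=0 and g="\<lambda>_. I"
      and L="\<lambda>a b c. c * of_real (1 + (cmod (of_real (v / 2) * (1 + c)))\<^sup>2)"])
    show "lvars (X + lconst (v\<^sup>2 / 4) * (1 + X)\<^sup>2) \<subseteq> {1, 2, 0}"
      by (intro lvars_subset_intros) auto
    show "leval (X + lconst (v\<^sup>2 / 4) * (1 + X)\<^sup>2) ((\<lambda>_. c)(1 := a, 2 := b)) =
        c * of_real (1 + (cmod (of_real (v / 2) * (1 + c)))\<^sup>2)"
      if "cmod a = 1" "cmod b = 1" "cmod c = 1" for a b c
    proof -
      have "((\<lambda>_. c)(1 := a, 2 := b)) i \<noteq> 0" for i :: nat using that by auto
      thus ?thesis unfolding circle_quadratic_factor[OF that(3), symmetric]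
        by (simp add: leval_add leval_mult leval_power)
    qed
    have "has_bochner_integral circle (\<lambda>c. ln (cmod (c * of_real (1 + (cmod (of_real (v / 2) * (1 + c)))\<^sup>2)))) I"
    proof (rule has_bochner_integral_circle_norm_cong[OF I])
      fix c assume "cmod c = 1"
      thus "k c = ln (cmod (c * of_real (1 + (cmod (of_real (v / 2) * (1 + c)))\<^sup>2)))"
        unfolding norm_mult norm_of_real k_def by simp
    qed measurable
    thus "AE p in circle \<Otimes>\<^sub>M circle. has_bochner_integral circle
      (\<lambda>c. ln (cmod (c * of_real (1 + (cmod (of_real (v / 2) * (1 + c)))\<^sup>2)))) I" by simp
    show "has_bochner_integral (circle \<Otimes>\<^sub>M circle) (\<lambda>_. I) I"
      using circle2.prob_space by (simp add: has_bochner_integral_iff)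
  qed simp
  with I show ?thesis unfolding k_def by simp
qed

text \<open>The polynomial is linear in z, and its constant coefficient has modulus 1 + |s|^2 > 0,
  so Jensen's formula applies at every point. The average over y is
  \<open>circle_mean_ln_max\<close>, whose two terms account for the Mahler measure and for the TI
  part.\<close>

lemma mahler_identity_2:
  fixes v :: real
  assumes v: "0 \<le> v"
  shows "mahler (X + lconst (v\<^sup>2 / 4) * (1 + X)\<^sup>2 + (Y + lconst (v / 2) * (1 + X))\<^sup>2 * Z) =
    2 / pi * TI v - 4 / pi\<^sup>2 * TS v 1 + 1 / 2 * mahler (X + lconst (v\<^sup>2 / 4) * (1 + X)\<^sup>2)"
proof -
  define s where "s a = of_real (v / 2) * (1 + a)" for a :: complex
  define g where "g p = ln (max (1 + (cmod (s (fst p)))\<^sup>2) ((cmod (snd p + s (fst p)))\<^sup>2))" for p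
  have [measurable]: "s \<in> borel_measurable borel" unfolding s_def by measurable
  show ?thesis
  proof (rule mahler_iterated[where i=0 and j=1 and k=2 and g=g
      and L="\<lambda>a b c. (a + of_real (v\<^sup>2 / 4) * (1 + a)\<^sup>2) + (b + s a)\<^sup>2 * c"])
    show "lvars (X + lconst (v\<^sup>2 / 4) * (1 + X)\<^sup>2 + (Y + lconst (v / 2) * (1 + X))\<^sup>2 * Z) \<subseteq> {0, 1, 2}"
      by (intro lvars_subset_intros) auto
    show "leval (X + lconst (v\<^sup>2 / 4) * (1 + X)\<^sup>2 + (Y + lconst (v / 2) * (1 + X))\<^sup>2 * Z) ((\<lambda>_. c)(0 := a, 1 := b)) =
        (a + of_real (v\<^sup>2 / 4) * (1 + a)\<^sup>2) + (b + s a)\<^sup>2 * c"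
      if "cmod a = 1" "cmod b = 1" "cmod c = 1" for a b c
    proof -
      have "((\<lambda>_. c)(0 := a, 1 := b)) i \<noteq> 0" for i :: nat using that by auto
      thus ?thesis by (simp add: leval_add leval_mult leval_power s_def)
    qed
    show "AE p in circle \<Otimes>\<^sub>M circle. has_bochner_integral circle
      (\<lambda>c. ln (cmod ((fst p + of_real (v\<^sup>2 / 4) * (1 + fst p)\<^sup>2) + (snd p + s (fst p))\<^sup>2 * c))) (g p)"
    proof (rule AE_mp[OF AE_torus_norm AE_I2], rule impI)
      fix p :: "complex \<times> complex" assume p: "cmod (fst p) = 1 \<and> cmod (snd p) = 1"
      have n: "cmod (fst p + of_real (v\<^sup>2 / 4) * (1 + fst p)\<^sup>2) = 1 + (cmod (s (fst p)))\<^sup>2"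
        using p by (subst circle_quadratic_factor) (auto simp: s_def norm_mult simp del: of_real_add of_real_mult of_real_power of_real_divide)
      hence "fst p + of_real (v\<^sup>2 / 4) * (1 + fst p)\<^sup>2 \<noteq> 0"
        by (metis add_pos_nonneg less_irrefl norm_zero zero_le_power2 zero_less_one)
      from circle_mean_ln_linear[OF disjI1[OF this], of "(snd p + s (fst p))\<^sup>2"]
      show "has_bochner_integral circle
      (\<lambda>c. ln (cmod ((fst p + of_real (v\<^sup>2 / 4) * (1 + fst p)\<^sup>2) + (snd p + s (fst p))\<^sup>2 * c))) (g p)"
        unfolding n g_def norm_power by simp
    qed
    show "has_bochner_integral (circle \<Otimes>\<^sub>M circle) g
      (2 / pi * TI v - 4 / pi\<^sup>2 * TS v 1 + 1 / 2 * mahler (X + lconst (v\<^sup>2 / 4) * (1 + X)\<^sup>2))"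
    proof (rule has_bochner_integral_torusI)
      show "g \<in> borel_measurable (borel \<Otimes>\<^sub>M borel)" unfolding g_def by measurable
      show "g (a, b) \<le> ln ((1 + v)\<^sup>2)" if "cmod a = 1" "cmod b = 1" for a b
      proof -
        have s: "cmod (s a) \<le> v"
        proof -
          have "cmod (s a) \<le> v / 2 * (1 + 1)"
            unfolding s_def norm_mult using that v norm_triangle_ineq[of 1 a] by (intro mult_mono) auto
          thus ?thesis by simp
        qed
        have "(cmod (b + s a))\<^sup>2 \<le> (1 + v)\<^sup>2"
          using norm_triangle_ineq[of b "s a"] that s by (intro power_mono) auto
        moreover have "(cmod (s a))\<^sup>2 \<le> v\<^sup>2" using s by (intro power_mono) auto
        moreover have "1 + v\<^sup>2 \<le> (1 + v)\<^sup>2" using v by (simp add: power2_sum)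
        ultimately have "1 + (cmod (s a))\<^sup>2 \<le> (1 + v)\<^sup>2" "(cmod (b + s a))\<^sup>2 \<le> (1 + v)\<^sup>2" by linarith+
        moreover have "0 < 1 + (cmod (s a))\<^sup>2" by (simp add: add_pos_nonneg)
        ultimately show ?thesis unfolding g_def by (intro ln_mono) (auto simp: less_max_iff_disj)
      qed
      show "has_bochner_integral circle (\<lambda>b. g (a, b)) (ln (1 + (cmod (s a))\<^sup>2) / 2 + 2 / pi * TI (cmod (s a)))" for a
        using circle_mean_ln_max by (simp add: g_def)
      have "has_bochner_integral circle (\<lambda>a. ln (1 + (cmod (s a))\<^sup>2) / 2 + 2 / pi * TI (cmod (s a)))
        (mahler (X + lconst (v\<^sup>2 / 4) * (1 + X)\<^sup>2) / 2 + 2 / pi * (TI v - 2 / pi * TS v 1))"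
        unfolding s_def
        by (intro has_bochner_integral_add has_bochner_integral_divide_zero has_bochner_integral_mult_right
            circle_mean_mahler_quadratic circle_mean_TI_norm v)
      thus "has_bochner_integral circle (\<lambda>a. ln (1 + (cmod (s a))\<^sup>2) / 2 + 2 / pi * TI (cmod (s a)))
        (2 / pi * TI v - 4 / pi\<^sup>2 * TS v 1 + 1 / 2 * mahler (X + lconst (v\<^sup>2 / 4) * (1 + X)\<^sup>2))"
        by (simp add: algebra_simps power2_eq_square)
    qed
  qed simp
qed

section \<open>The third and fourth identities\<close>

lemma max_abs_add_diff: "0 \<le> x \<Longrightarrow> max \<bar>x + y\<bar> \<bar>x - y\<bar> = x + \<bar>y\<bar>" for x y :: real
  by (auto simp: max_def abs_if)

text \<open>On the torus x + 1 / x and z + 1 / z are real, so the coefficients in y are the real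
  numbers E + N and E - N with E > 0. The larger modulus is E + |N| = 1 + c^2 + 2 c |Re z| with c =
  v |Re x|.\<close>

lemma mahler_identity_3:
  fixes v :: real
  assumes v: "0 \<le> v"
  shows "mahler ((1 + Y) * (1 + lconst (v\<^sup>2 / 4) * (X + X_inv)\<^sup>2)
             + lconst (v / 2) * (1 - Y) * (X + X_inv) * (Z + Z_inv)) =
       4 / pi * TI v - 8 / pi\<^sup>2 * TS v 1"
proof -
  define t where "t a = v * Re a" for a :: complex
  define E where "E a = 1 + (t a)\<^sup>2" for a
  define g where "g p = ln (1 + (v * \<bar>Re (fst p)\<bar>)\<^sup>2 + 2 * (v * \<bar>Re (fst p)\<bar>) * \<bar>Re (snd p)\<bar>)" for p :: "complex \<times> complex"
  show ?thesis
  proof (rule mahler_iterated[where i=0 and j=2 and k=1 and g=g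
      and L="\<lambda>a b c. of_real (E a + 2 * t a * Re b) + of_real (E a - 2 * t a * Re b) * c"])
    show "lvars ((1 + Y) * (1 + lconst (v\<^sup>2 / 4) * (X + X_inv)\<^sup>2)
             + lconst (v / 2) * (1 - Y) * (X + X_inv) * (Z + Z_inv)) \<subseteq> {0, 2, 1}"
      by (intro lvars_subset_intros) auto
    show "leval ((1 + Y) * (1 + lconst (v\<^sup>2 / 4) * (X + X_inv)\<^sup>2)
             + lconst (v / 2) * (1 - Y) * (X + X_inv) * (Z + Z_inv)) ((\<lambda>_. c)(0 := a, 2 := b)) =
        of_real (E a + 2 * t a * Re b) + of_real (E a - 2 * t a * Re b) * c"
      if "cmod a = 1" "cmod b = 1" "cmod c = 1" for a b c
    proof -
      have "((\<lambda>_. c)(0 := a, 2 := b)) i \<noteq> 0" for i :: nat using that by auto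
      hence "leval ((1 + Y) * (1 + lconst (v\<^sup>2 / 4) * (X + X_inv)\<^sup>2)
             + lconst (v / 2) * (1 - Y) * (X + X_inv) * (Z + Z_inv)) ((\<lambda>_. c)(0 := a, 2 := b)) =
        (1 + c) * (1 + of_real (v\<^sup>2 / 4) * (a + inverse a)\<^sup>2) + of_real (v / 2) * (1 - c) * (a + inverse a) * (b + inverse b)"
        by (simp add: leval_add leval_mult leval_diff leval_power)
      also have "\<dots> = of_real (E a + 2 * t a * Re b) + of_real (E a - 2 * t a * Re b) * c"
        unfolding circle_Re_Im(1)[OF that(1)] circle_Re_Im(1)[OF that(2)] E_def t_def
        by (simp add: field_simps power2_eq_square)
      finally show ?thesis .
    qed
    show "AE p in circle \<Otimes>\<^sub>M circle. has_bochner_integral circle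
      (\<lambda>c. ln (cmod (of_real (E (fst p) + 2 * t (fst p) * Re (snd p)) + of_real (E (fst p) - 2 * t (fst p) * Re (snd p)) * c))) (g p)"
    proof (rule AE_I2)
      fix p :: "complex \<times> complex"
      let ?E = "E (fst p)" and ?N = "2 * t (fst p) * Re (snd p)"
      have E: "0 < ?E" by (simp add: E_def add_pos_nonneg)
      hence nz: "complex_of_real (?E + ?N) \<noteq> 0 \<or> complex_of_real (?E - ?N) \<noteq> 0"
        unfolding of_real_eq_0_iff by linarith
      have "max (cmod (of_real (?E + ?N))) (cmod (of_real (?E - ?N))) = ?E + \<bar>?N\<bar>"
        unfolding norm_of_real using E by (intro max_abs_add_diff) simp
      also have "\<dots> = 1 + (v * \<bar>Re (fst p)\<bar>)\<^sup>2 + 2 * (v * \<bar>Re (fst p)\<bar>) * \<bar>Re (snd p)\<bar>"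
        using v by (simp add: E_def t_def abs_mult power_mult_distrib)
      finally show "has_bochner_integral circle
        (\<lambda>c. ln (cmod (of_real (?E + ?N) + of_real (?E - ?N) * c))) (g p)"
        using circle_mean_ln_linear[OF nz] by (simp only: g_def)
    qed
    show "has_bochner_integral (circle \<Otimes>\<^sub>M circle) g (4 / pi * TI v - 8 / pi\<^sup>2 * TS v 1)"
    proof (rule has_bochner_integral_torusI)
      show "g \<in> borel_measurable (borel \<Otimes>\<^sub>M borel)" unfolding g_def by measurable
      show "g (a, b) \<le> ln (1 + v\<^sup>2 + 2 * v * 1)" if "cmod a = 1" "cmod b = 1" for a b
      proof -
        have le: "v * \<bar>Re a\<bar> \<le> v" using circle_Re_Im(4)[OF that(1)] v mult_left_mono[of "\<bar>Re a\<bar>" 1 v] by simp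
        hence "1 + (v * \<bar>Re a\<bar>)\<^sup>2 + 2 * (v * \<bar>Re a\<bar>) * \<bar>Re b\<bar> \<le> 1 + v\<^sup>2 + 2 * v * 1"
          using v circle_Re_Im(4)[OF that(2)] by (intro add_mono mult_mono power_mono) auto
        thus ?thesis unfolding g_def fst_conv snd_conv using v
          by (intro ln_mono one_plus_sq_pos) auto
      qed
      show "has_bochner_integral circle (\<lambda>b. g (a, b)) (4 / pi * TI (v * \<bar>Re a\<bar>))" for a
        unfolding g_def fst_conv snd_conv using v by (intro circle_mean_ln_abs_Re) simp
      have "has_bochner_integral circle (\<lambda>a. 4 / pi * TI (v * \<bar>Re a\<bar>)) (4 / pi * (TI v - 2 / pi * TS v 1))"
        by (intro has_bochner_integral_mult_right circle_mean_TI v)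
      thus "has_bochner_integral circle (\<lambda>a. 4 / pi * TI (v * \<bar>Re a\<bar>)) (4 / pi * TI v - 8 / pi\<^sup>2 * TS v 1)"
        by (simp add: algebra_simps power2_eq_square)
    qed
  qed simp
qed

text \<open>In z this is the form d (z - 1 / z) + c with d = 1 and c = 2 r, where r = v Re x Re y.
  Its mean ln (|r| + sqrt (r^2 + 1)) is the inverse hyperbolic sine of |r|.\<close>

lemma mahler_identity_4:
  fixes v :: real
  assumes v: "0 \<le> v"
  shows "mahler ((Z - Z_inv) + lconst (v / 2) * (X + X_inv) * (Y + Y_inv)) =
       2 / pi * TI v - 4 / pi\<^sup>2 * TS v 1"
proof -
  define g where "g p = arsinh (v * \<bar>Re (fst p)\<bar> * \<bar>Re (snd p)\<bar>)" for p :: "complex \<times> complex"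
  show ?thesis
  proof (rule mahler_iterated[where i=0 and j=1 and k=2 and g=g
      and L="\<lambda>a b c. of_real 1 * (c - inverse c) + of_real (2 * (v * Re a * Re b))"])
    show "lvars ((Z - Z_inv) + lconst (v / 2) * (X + X_inv) * (Y + Y_inv)) \<subseteq> {0, 1, 2}"
      by (intro lvars_subset_intros) auto
    show "leval ((Z - Z_inv) + lconst (v / 2) * (X + X_inv) * (Y + Y_inv)) ((\<lambda>_. c)(0 := a, 1 := b)) =
        of_real 1 * (c - inverse c) + of_real (2 * (v * Re a * Re b))"
      if "cmod a = 1" "cmod b = 1" "cmod c = 1" for a b c
    proof -
      have "((\<lambda>_. c)(0 := a, 1 := b)) i \<noteq> 0" for i :: nat using that by auto
      hence "leval ((Z - Z_inv) + lconst (v / 2) * (X + X_inv) * (Y + Y_inv)) ((\<lambda>_. c)(0 := a, 1 := b)) =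
        (c - inverse c) + of_real (v / 2) * (a + inverse a) * (b + inverse b)"
        by (simp add: leval_add leval_mult leval_diff)
      also have "\<dots> = of_real 1 * (c - inverse c) + of_real (2 * (v * Re a * Re b))"
        unfolding circle_Re_Im(1)[OF that(1)] circle_Re_Im(1)[OF that(2)] by simp
      finally show ?thesis .
    qed
    show "AE p in circle \<Otimes>\<^sub>M circle. has_bochner_integral circle
      (\<lambda>c. ln (cmod (of_real 1 * (c - inverse c) + of_real (2 * (v * Re (fst p) * Re (snd p)))))) (g p)"
    proof (rule AE_I2)
      fix p :: "complex \<times> complex"
      define r where "r = v * Re (fst p) * Re (snd p)"
      have "(2 * r)\<^sup>2 + 4 * 1\<^sup>2 = 2\<^sup>2 * (r\<^sup>2 + 1)" by (simp add: power2_eq_square)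
      hence "sqrt ((2 * r)\<^sup>2 + 4 * 1\<^sup>2) = 2 * sqrt (r\<^sup>2 + 1)" by (simp only: real_sqrt_mult) simp
      hence "(\<bar>2 * r\<bar> + sqrt ((2 * r)\<^sup>2 + 4 * 1\<^sup>2)) / 2 = \<bar>r\<bar> + sqrt (\<bar>r\<bar>\<^sup>2 + 1)" by simp
      hence "ln ((\<bar>2 * r\<bar> + sqrt ((2 * r)\<^sup>2 + 4 * 1\<^sup>2)) / 2) = arsinh \<bar>r\<bar>"
        by (simp only: arsinh_real_def)
      moreover have "\<bar>r\<bar> = v * \<bar>Re (fst p)\<bar> * \<bar>Re (snd p)\<bar>" using v by (simp add: r_def abs_mult)
      ultimately show "has_bochner_integral circle
        (\<lambda>c. ln (cmod (of_real 1 * (c - inverse c) + of_real (2 * (v * Re (fst p) * Re (snd p)))))) (g p)"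
        using circle_mean_ln_quadratic[of "2 * r" 1] unfolding r_def[symmetric] g_def by simp
    qed
    show "has_bochner_integral (circle \<Otimes>\<^sub>M circle) g (2 / pi * TI v - 4 / pi\<^sup>2 * TS v 1)"
    proof (rule has_bochner_integral_torusI)
      show "g \<in> borel_measurable (borel \<Otimes>\<^sub>M borel)" unfolding g_def arsinh_real_def by measurable
      show "g (a, b) \<le> arsinh (v * 1 * 1)" if "cmod a = 1" "cmod b = 1" for a b
      proof -
        have "v * \<bar>Re a\<bar> * \<bar>Re b\<bar> \<le> v * 1 * 1"
          using v circle_Re_Im(4)[OF that(1)] circle_Re_Im(4)[OF that(2)] by (intro mult_mono) auto
        thus ?thesis by (simp add: g_def not_less[symmetric])
      qed
      show "has_bochner_integral circle (\<lambda>b. g (a, b)) (2 / pi * TI (v * \<bar>Re a\<bar>))" for a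
        unfolding g_def fst_conv snd_conv using v by (intro circle_mean_arsinh_abs_Re) simp
      have "has_bochner_integral circle (\<lambda>a. 2 / pi * TI (v * \<bar>Re a\<bar>)) (2 / pi * (TI v - 2 / pi * TS v 1))"
        by (intro has_bochner_integral_mult_right circle_mean_TI v)
      thus "has_bochner_integral circle (\<lambda>a. 2 / pi * TI (v * \<bar>Re a\<bar>)) (2 / pi * TI v - 4 / pi\<^sup>2 * TS v 1)"
        by (simp add: algebra_simps power2_eq_square)
    qed
  qed simp
qed

section \<open>Elliptical radii and the fifth identity\<close>

lemma circle_mean_ln_conj_linear:
  fixes p q :: real
  assumes "p \<noteq> 0 \<or> q \<noteq> 0"
  shows "has_bochner_integral circle (\<lambda>b. ln (cmod (of_real p * b + of_real q * cnj b))) (ln (max \<bar>p\<bar> \<bar>q\<bar>))"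
proof (rule has_bochner_integral_circle_norm_cong)
  have "has_bochner_integral circle (\<lambda>b. ln (cmod (of_real q + of_real p * b))) (ln (max \<bar>q\<bar> \<bar>p\<bar>))"
    using circle_mean_ln_linear[of "of_real q" "of_real p"] assms by auto
  from has_bochner_integral_circle_square[OF this]
  show "has_bochner_integral circle (\<lambda>b. ln (cmod (of_real q + of_real p * b\<^sup>2))) (ln (max \<bar>p\<bar> \<bar>q\<bar>))"
    by (simp add: max.commute)
  fix b assume b: "cmod b = 1"
  \<comment> \<open>Multiplication by b keeps the modulus and leaves a linear polynomial in b^2,
    whose mean is that of the linear polynomial itself.\<close>
  have "cnj b * b = 1" using complex_norm_square[of b] b by (simp add: mult.commute)
  hence "b * (of_real p * b + of_real q * cnj b) = of_real q + of_real p * b\<^sup>2"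
    by (simp add: algebra_simps power2_eq_square)
  hence "cmod (of_real p * b + of_real q * cnj b) = cmod (of_real q + of_real p * b\<^sup>2)"
    using b by (metis mult_1 norm_mult)
  thus "ln (cmod (of_real q + of_real p * b\<^sup>2)) = ln (cmod (of_real p * b + of_real q * cnj b))" by simp
qed measurable

text \<open>The distance from the origin to the image of b on an ellipse with semi-axes 1 + t^2 and
  2 |t|. For t = v |Re x| its square is, up to the factor 4, the coefficient of (1 + y)^2 in the
  fifth polynomial.\<close>

definition ellipse :: "real \<Rightarrow> complex \<Rightarrow> real"
  where "ellipse t b = sqrt (((1 + t\<^sup>2) * Re b)\<^sup>2 + 4 * (t * Im b)\<^sup>2)"

lemma borel_measurable_ellipse [measurable]: "ellipse t \<in> borel_measurable borel"
  unfolding ellipse_def by measurable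

lemma ellipse_ge: "(1 + t\<^sup>2) * \<bar>Re b\<bar> \<le> ellipse t b"
proof -
  have "\<bar>(1 + t\<^sup>2) * Re b\<bar> \<le> ellipse t b"
    unfolding ellipse_def by (rule real_le_rsqrt) simp
  thus ?thesis by (simp add: abs_mult)
qed

lemma ellipse_pos:
  assumes "Re b \<noteq> 0"
  shows "0 < ellipse t b"
proof -
  have "0 < (1 + t\<^sup>2) * \<bar>Re b\<bar>" using assms by (simp add: add_pos_nonneg)
  thus ?thesis using ellipse_ge[of t b] by linarith
qed

lemma AE_circle_Re_neq_0: "AE b in circle. Re b \<noteq> 0"
proof (rule AE_mp[OF AE_circle_norm], rule AE_mp[OF AE_circle_neq[of \<i>]],
    rule AE_mp[OF AE_circle_neq[of "- \<i>"] AE_I2], intro impI notI)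
  fix b assume b: "b \<noteq> - \<i>" "b \<noteq> \<i>" "cmod b = 1" "Re b = 0"
  hence "\<bar>Im b\<bar> = 1" by (simp add: cmod_eq_Im)
  thus False using b by (auto simp: complex_eq_iff abs_if split: if_splits)
qed

lemma circle_mean_ln_ellipse:
  "has_bochner_integral circle (\<lambda>b. ln (ellipse t b)) (2 * ln (1 + \<bar>t\<bar>) - ln 2)"
proof -
  \<comment> \<open>Chosen so that p + q and p - q are the signed semi-axes; p b + q cnj b then runs
    over the ellipse. Both numbers are halves of squares, and the larger is (1 + |t|)^2 / 2.\<close>
  define p q where "p = (1 + t)\<^sup>2 / 2" and "q = (1 - t)\<^sup>2 / 2"
  have pq: "p + q = 1 + t\<^sup>2" "p - q = 2 * t" by (simp_all add: p_def q_def power2_eq_square field_simps)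
  have "0 < p + q" unfolding pq by (simp add: add_pos_nonneg)
  hence nz: "p \<noteq> 0 \<or> q \<noteq> 0" by auto
  have "p = (1 + t\<^sup>2) / 2 + t" "q = (1 + t\<^sup>2) / 2 - t" using pq by (simp_all add: field_simps)
  hence "max \<bar>p\<bar> \<bar>q\<bar> = (1 + t\<^sup>2) / 2 + \<bar>t\<bar>" by (simp add: max_abs_add_diff)
  also have "\<dots> = (1 + \<bar>t\<bar>)\<^sup>2 / 2" by (simp add: power2_sum add_divide_distrib)
  finally have mx: "max \<bar>p\<bar> \<bar>q\<bar> = (1 + \<bar>t\<bar>)\<^sup>2 / 2" .
  have val: "ln (max \<bar>p\<bar> \<bar>q\<bar>) = 2 * ln (1 + \<bar>t\<bar>) - ln 2"
  proof -
    have "ln ((1 + \<bar>t\<bar>)\<^sup>2 / 2) = ln ((1 + \<bar>t\<bar>)\<^sup>2) - ln 2"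
      by (rule ln_divide_pos) (simp_all add: add_pos_nonneg)
    thus ?thesis unfolding mx by (simp add: ln_realpow)
  qed
  have "cmod (of_real p * b + of_real q * cnj b) = ellipse t b" for b
  proof -
    have "of_real p * b + of_real q * cnj b = Complex ((p + q) * Re b) ((p - q) * Im b)"
      by (simp add: complex_eq_iff algebra_simps)
    thus ?thesis unfolding pq by (simp add: ellipse_def complex_norm power_mult_distrib)
  qed
  thus ?thesis using circle_mean_ln_conj_linear[OF nz] by (simp only: val)
qed

text \<open>The mean of \<open>ln (ellipse + \<bar>Re\<bar>)\<close> is obtained from the mean of
  \<open>ln \<bar>(1 + t\<^sup>2) Re b + 2 \<i> t Im w Im b\<bar>\<close> over the torus, computed in both orders.\<close>

lemma circle_mean_ln_ellipse_plus:
  "has_bochner_integral circle (\<lambda>b. ln (ellipse t b + (1 + t\<^sup>2) * \<bar>Re b\<bar>)) (4 / pi * TI \<bar>t\<bar>)"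
proof -
  define L where "L w b = of_real (t * Im b) * (w - inverse w) + of_real ((1 + t\<^sup>2) * Re b)" for w b :: complex
  define f where "f p = ln (cmod (L (fst p) (snd p)))" for p
  have fm: "f \<in> borel_measurable (borel \<Otimes>\<^sub>M borel)" unfolding f_def L_def by measurable
  have "has_bochner_integral (circle \<Otimes>\<^sub>M circle) f (4 / pi * TI \<bar>t\<bar> - ln 2)"
  proof (rule has_bochner_integral_torusI[OF fm])
    fix w b assume w: "cmod w = 1" and b: "cmod b = 1"
    have "cmod (w - inverse w) \<le> 1 + 1"
      using norm_triangle_ineq4[of w "inverse w"] w by (simp add: norm_inverse)
    hence "\<bar>t\<bar> * \<bar>Im b\<bar> * cmod (w - inverse w) \<le> \<bar>t\<bar> * 1 * (1 + 1)"
      using circle_Re_Im(5)[OF b] by (intro mult_mono) auto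
    moreover have "(1 + t\<^sup>2) * \<bar>Re b\<bar> \<le> (1 + t\<^sup>2) * 1"
      using circle_Re_Im(4)[OF b] by (intro mult_left_mono) auto
    moreover have "cmod (L w b) \<le> \<bar>t\<bar> * \<bar>Im b\<bar> * cmod (w - inverse w) + (1 + t\<^sup>2) * \<bar>Re b\<bar>"
      unfolding L_def by (rule order.trans[OF norm_triangle_ineq])
        (simp only: norm_mult norm_of_real abs_mult, simp)
    ultimately have "cmod (L w b) \<le> \<bar>t\<bar> * 1 * (1 + 1) + (1 + t\<^sup>2) * 1" by linarith
    thus "f (w, b) \<le> max 0 (ln (\<bar>t\<bar> * 1 * (1 + 1) + (1 + t\<^sup>2) * 1))"
      unfolding f_def fst_conv snd_conv by (rule ln_norm_le)
  next
    \<comment> \<open>For fixed w the difference w - 1 / w is purely imaginary, so L w b = p b + q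
      cnj b with real p and q, and the mean over b is the logarithm of the larger modulus.\<close>
    fix w assume w: "cmod w = 1"
    define p q where "p = (1 + t\<^sup>2) / 2 + t * Im w" and "q = (1 + t\<^sup>2) / 2 - t * Im w"
    have pq: "p + q = 1 + t\<^sup>2" "p - q = 2 * t * Im w" by (simp_all add: p_def q_def)
    have "0 < p + q" unfolding pq by (simp add: add_pos_nonneg)
    hence nz: "p \<noteq> 0 \<or> q \<noteq> 0" by auto
    have "max \<bar>p\<bar> \<bar>q\<bar> = (1 + t\<^sup>2) / 2 + \<bar>t * Im w\<bar>"
      unfolding p_def q_def by (rule max_abs_add_diff) simp
    also have "\<dots> = (1 + \<bar>t\<bar>\<^sup>2 + 2 * \<bar>t\<bar> * \<bar>Im w\<bar>) / 2" by (simp add: abs_mult)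
    finally have "ln (max \<bar>p\<bar> \<bar>q\<bar>) = ln ((1 + \<bar>t\<bar>\<^sup>2 + 2 * \<bar>t\<bar> * \<bar>Im w\<bar>) / 2)" by (rule arg_cong)
    also have "\<dots> = ln (1 + \<bar>t\<bar>\<^sup>2 + 2 * \<bar>t\<bar> * \<bar>Im w\<bar>) - ln 2"
      using one_plus_sq_pos[of "\<bar>t\<bar>" "\<bar>Im w\<bar>"] by (intro ln_divide_pos) auto
    finally have val: "ln (max \<bar>p\<bar> \<bar>q\<bar>) = ln (1 + \<bar>t\<bar>\<^sup>2 + 2 * \<bar>t\<bar> * \<bar>Im w\<bar>) - ln 2" .
    have eq: "of_real p * b + of_real q * cnj b = L w b" for b
    proof -
      have "of_real p * b + of_real q * cnj b = Complex ((p + q) * Re b) ((p - q) * Im b)"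
        by (simp add: complex_eq_iff algebra_simps)
      thus ?thesis unfolding pq L_def circle_Re_Im(2)[OF w] by (simp add: complex_eq_iff)
    qed
    show "has_bochner_integral circle (\<lambda>b. f (w, b)) (ln (1 + \<bar>t\<bar>\<^sup>2 + 2 * \<bar>t\<bar> * \<bar>Im w\<bar>) - ln 2)"
      using circle_mean_ln_conj_linear[OF nz] unfolding eq val by (simp add: f_def)
  next
    \<comment> \<open>Rotation by - \<i> turns the real part into the imaginary part.\<close>
    have "has_bochner_integral circle (\<lambda>w. ln (1 + \<bar>t\<bar>\<^sup>2 + 2 * \<bar>t\<bar> * \<bar>Re (- \<i> * w)\<bar>)) (4 / pi * TI \<bar>t\<bar>)"
      by (rule has_bochner_integral_circle_rotate[OF _ circle_mean_ln_abs_Re]) auto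
    thus "has_bochner_integral circle (\<lambda>w. ln (1 + \<bar>t\<bar>\<^sup>2 + 2 * \<bar>t\<bar> * \<bar>Im w\<bar>) - ln 2) (4 / pi * TI \<bar>t\<bar> - ln 2)"
      by (intro has_bochner_integral_diff has_bochner_integral_circle_const) simp
  qed
  \<comment> \<open>In the other order, b is fixed and L is of the form d (w - 1 / w) + c. The
    condition Re b \<noteq> 0 excludes the degenerate case c = d = 0, and the root in the value of
    the mean is the elliptical radius.\<close>
  moreover have "AE b in circle. (\<integral>w. f (w, b) \<partial>circle) = ln ((ellipse t b + (1 + t\<^sup>2) * \<bar>Re b\<bar>) / 2)"
  proof (rule AE_mp[OF AE_circle_Re_neq_0 AE_I2], rule impI)
    fix b assume "Re b \<noteq> 0"
    moreover have "1 + t\<^sup>2 \<noteq> 0" using add_pos_nonneg[of 1 "t\<^sup>2"] by simp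
    ultimately have "(1 + t\<^sup>2) * Re b \<noteq> 0 \<or> t * Im b \<noteq> 0" by simp
    from circle_mean_ln_quadratic[OF this]
    have "has_bochner_integral circle (\<lambda>w. f (w, b)) (ln ((\<bar>(1 + t\<^sup>2) * Re b\<bar> + ellipse t b) / 2))"
      by (simp only: f_def L_def fst_conv snd_conv ellipse_def)
    thus "(\<integral>w. f (w, b) \<partial>circle) = ln ((ellipse t b + (1 + t\<^sup>2) * \<bar>Re b\<bar>) / 2)"
      by (simp add: has_bochner_integral_iff abs_mult add.commute)
  qed
  ultimately have "has_bochner_integral circle (\<lambda>b. ln ((ellipse t b + (1 + t\<^sup>2) * \<bar>Re b\<bar>) / 2)) (4 / pi * TI \<bar>t\<bar> - ln 2)"
    by (rule has_bochner_integral_pair_swapI[OF circle.prob_space_axioms circle.prob_space_axioms]) measurable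
  from has_bochner_integral_add[OF this has_bochner_integral_circle_const[of "ln 2"]]
  have "has_bochner_integral circle (\<lambda>b. ln ((ellipse t b + (1 + t\<^sup>2) * \<bar>Re b\<bar>) / 2) + ln 2) (4 / pi * TI \<bar>t\<bar>)"
    by simp
  moreover have "AE b in circle. ln ((ellipse t b + (1 + t\<^sup>2) * \<bar>Re b\<bar>) / 2) + ln 2 = ln (ellipse t b + (1 + t\<^sup>2) * \<bar>Re b\<bar>)"
  proof (rule AE_mp[OF AE_circle_Re_neq_0 AE_I2], rule impI)
    fix b assume "Re b \<noteq> 0"
    hence "0 < ellipse t b + (1 + t\<^sup>2) * \<bar>Re b\<bar>" by (intro add_pos_nonneg ellipse_pos) auto
    thus "ln ((ellipse t b + (1 + t\<^sup>2) * \<bar>Re b\<bar>) / 2) + ln 2 = ln (ellipse t b + (1 + t\<^sup>2) * \<bar>Re b\<bar>)"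
      by (simp add: ln_divide_pos)
  qed
  ultimately show ?thesis
    by (rule has_bochner_integral_circle_AE_cong) measurable
qed

text \<open>The factors are S c + (S - C) and S c + (S + C). Since 0 \<le> C \<le> S, the leading
  coefficient dominates in the first and the constant term in the second, which gives S and S +
  C.\<close>

lemma circle_mean_ln_difference_squares:
  fixes S C :: real
  assumes "0 < S" "0 \<le> C" "C \<le> S"
  shows "has_bochner_integral circle (\<lambda>c. ln (cmod (4 * ((1 + c)\<^sup>2 * of_real (S\<^sup>2) - of_real (C\<^sup>2))))) (ln 4 + ln S + ln (S + C))"
proof -
  have m: "has_bochner_integral circle (\<lambda>c. ln (cmod (of_real (S - C) + of_real S * c))) (ln S)"
    using circle_mean_ln_linear[of "of_real (S - C)" "of_real S"] assms by (simp add: max_absorb2 flip: of_real_diff)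
  have p: "has_bochner_integral circle (\<lambda>c. ln (cmod (of_real (S + C) + of_real S * c))) (ln (S + C))"
    using circle_mean_ln_linear[of "of_real (S + C)" "of_real S"] assms by (simp add: max_absorb1 flip: of_real_add)
  have S: "complex_of_real S \<noteq> 0" using assms by simp
  show ?thesis
  proof (rule has_bochner_integral_circle_AE_cong[OF has_bochner_integral_add[OF
        has_bochner_integral_add[OF has_bochner_integral_circle_const m] p]])
    show "AE c in circle. ln 4 + ln (cmod (of_real (S - C) + of_real S * c)) + ln (cmod (of_real (S + C) + of_real S * c)) =
      ln (cmod (4 * ((1 + c)\<^sup>2 * of_real (S\<^sup>2) - of_real (C\<^sup>2))))"
    proof (rule AE_mp[OF AE_circle_linear_neq_0[OF disjI2[OF S]]],
        rule AE_mp[OF AE_circle_linear_neq_0[OF disjI2[OF S]] AE_I2], intro impI)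
      fix c :: complex assume nz: "of_real (S - C) + of_real S * c \<noteq> 0" "of_real (S + C) + of_real S * c \<noteq> 0"
      have "4 * ((1 + c)\<^sup>2 * of_real (S\<^sup>2) - of_real (C\<^sup>2)) =
          4 * ((of_real (S - C) + of_real S * c) * (of_real (S + C) + of_real S * c))"
        by (simp add: power2_eq_square algebra_simps)
      thus "ln 4 + ln (cmod (of_real (S - C) + of_real S * c)) + ln (cmod (of_real (S + C) + of_real S * c)) =
          ln (cmod (4 * ((1 + c)\<^sup>2 * of_real (S\<^sup>2) - of_real (C\<^sup>2))))"
        using nz by (simp only: norm_mult ln_mult) simp
    qed
  qed measurable
qed

text \<open>With T = t^2, x = Re b and y = Im b, the coefficient of 4 (1 + c)^2 on the torus is (1 +
  T)^2 - y^2 (1 - T)^2, which x^2 + y^2 = 1 turns into S^2 = (1 + T)^2 x^2 + 4 T y^2; what remains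
  is - 4 C^2. The inner average is ln 4 + ln S + ln (S + C). The mean of ln S supplies 2 ln (1 + t)
  - ln 2 and thus the integral of ln (1 + v sin \<theta>), ln (S + C) supplies the TI term, and ln 4
  - ln 2 leaves ln 2.\<close>

lemma mahler_identity_5:
  fixes v :: real
  assumes v: "0 \<le> v"
  shows "mahler ((4 * (1 + Y)\<^sup>2 - (Z + Z_inv)\<^sup>2) * (1 + lconst (v\<^sup>2 / 4) * (X + X_inv)\<^sup>2)\<^sup>2
             + (Z - Z_inv)\<^sup>2 * (1 + Y)\<^sup>2 * (1 - lconst (v\<^sup>2 / 4) * (X + X_inv)\<^sup>2)\<^sup>2) =
       4 / pi * TI v - 8 / pi\<^sup>2 * TS v 1 + 4 / pi * integral {0..pi / 2} (\<lambda>\<theta>. ln (1 + v * sin \<theta>)) + ln 2"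
    (is "mahler ?P = ?m")
proof -
  define t where "t a = v * \<bar>Re a\<bar>" for a :: complex
  define C where "C a b = (1 + (t a)\<^sup>2) * \<bar>Re b\<bar>" for a b
  define S where "S a b = ellipse (t a) b" for a b
  define g where "g p = ln 4 + ln (S (fst p) (snd p)) + ln (S (fst p) (snd p) + C (fst p) (snd p))" for p
  have t0: "0 \<le> t a" for a using v by (simp add: t_def)
  show ?thesis
  proof (rule mahler_iterated[where i=0 and j=2 and k=1 and g=g
      and L="\<lambda>a b c. 4 * ((1 + c)\<^sup>2 * of_real ((S a b)\<^sup>2) - of_real ((C a b)\<^sup>2))"])
    show "lvars ?P \<subseteq> {0, 2, 1}"
      by (intro lvars_subset_intros) auto
    show "leval ?P ((\<lambda>_. c)(0 := a, 2 := b)) = 4 * ((1 + c)\<^sup>2 * of_real ((S a b)\<^sup>2) - of_real ((C a b)\<^sup>2))"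
      if a: "cmod a = 1" and b: "cmod b = 1" and c: "cmod c = 1" for a b c
    proof -
      define x y T where "x = complex_of_real (Re b)" and "y = complex_of_real (Im b)" and "T = complex_of_real ((t a)\<^sup>2)"
      have "((\<lambda>_. c)(0 := a, 2 := b)) i \<noteq> 0" for i :: nat using that by auto
      hence "leval ?P ((\<lambda>_. c)(0 := a, 2 := b)) =
        (4 * (1 + c)\<^sup>2 - (b + inverse b)\<^sup>2) * (1 + of_real (v\<^sup>2 / 4) * (a + inverse a)\<^sup>2)\<^sup>2
         + (b - inverse b)\<^sup>2 * (1 + c)\<^sup>2 * (1 - of_real (v\<^sup>2 / 4) * (a + inverse a)\<^sup>2)\<^sup>2"
        by (simp add: leval_add leval_mult leval_diff leval_power)
      also have "of_real (v\<^sup>2 / 4) * (a + inverse a)\<^sup>2 = T"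
        unfolding circle_Re_Im(1)[OF a] T_def t_def by (simp add: power_mult_distrib flip: of_real_power)
      also have "b + inverse b = 2 * x" unfolding circle_Re_Im(1)[OF b] x_def by simp
      also have "b - inverse b = 2 * y * \<i>" unfolding circle_Re_Im(2)[OF b] y_def by simp
      finally have 1: "leval ?P ((\<lambda>_. c)(0 := a, 2 := b)) =
        (4 * (1 + c)\<^sup>2 - (2 * x)\<^sup>2) * (1 + T)\<^sup>2 + (2 * y * \<i>)\<^sup>2 * (1 + c)\<^sup>2 * (1 - T)\<^sup>2" .
      have xy: "x\<^sup>2 + y\<^sup>2 = 1"
        using circle_Re_Im(3)[OF b] unfolding x_def y_def by (simp flip: of_real_power of_real_add)
      have "(S a b)\<^sup>2 = ((1 + (t a)\<^sup>2) * Re b)\<^sup>2 + 4 * (t a * Im b)\<^sup>2"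
        unfolding S_def ellipse_def by simp
      hence S: "of_real ((S a b)\<^sup>2) = (1 + T)\<^sup>2 * x\<^sup>2 + 4 * T * y\<^sup>2"
        unfolding x_def y_def T_def by (simp add: power_mult_distrib)
      have C: "of_real ((C a b)\<^sup>2) = (1 + T)\<^sup>2 * x\<^sup>2"
        unfolding C_def x_def T_def power_mult_distrib power2_abs by simp
      have i2: "\<i>\<^sup>2 = -1" by simp
      show ?thesis
        unfolding 1 S C using xy i2 by algebra
    qed
    show "AE p in circle \<Otimes>\<^sub>M circle. has_bochner_integral circle
      (\<lambda>c. ln (cmod (4 * ((1 + c)\<^sup>2 * of_real ((S (fst p) (snd p))\<^sup>2) - of_real ((C (fst p) (snd p))\<^sup>2))))) (g p)"
    proof -
      have "AE p in circle \<Otimes>\<^sub>M circle. Re (snd p) \<noteq> 0"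
      proof (rule circle2.AE_pair_measure)
        show "{p \<in> space (circle \<Otimes>\<^sub>M circle). Re (snd p) \<noteq> 0} \<in> sets (circle \<Otimes>\<^sub>M circle)"
          by measurable
      qed (use AE_circle_Re_neq_0 in simp)
      thus ?thesis
      proof (rule AE_mp[OF _ AE_I2], intro impI)
        fix p :: "complex \<times> complex" assume "Re (snd p) \<noteq> 0"
        thus "has_bochner_integral circle
          (\<lambda>c. ln (cmod (4 * ((1 + c)\<^sup>2 * of_real ((S (fst p) (snd p))\<^sup>2) - of_real ((C (fst p) (snd p))\<^sup>2))))) (g p)"
          unfolding g_def by (intro circle_mean_ln_difference_squares) (auto simp: S_def C_def ellipse_pos ellipse_ge)
      qed
    qed
    show "has_bochner_integral (circle \<Otimes>\<^sub>M circle) g ?m"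
    proof (rule has_bochner_integral_torusI)
      show "g \<in> borel_measurable (borel \<Otimes>\<^sub>M borel)"
        unfolding g_def S_def C_def t_def ellipse_def by measurable
      \<comment> \<open>A crude bound: C \<le> 1 + v^2, and S \<le> C + 2 v with 2 v \<le> 1 +
        v^2.\<close>
      define B where "B = 3 * (1 + v\<^sup>2)"
      show "g (a, b) \<le> ln 4 + max 0 (ln B) + max 0 (ln (2 * B))" if "cmod a = 1" "cmod b = 1" for a b
      proof -
        have t: "t a \<le> v" using circle_Re_Im(4)[OF that(1)] v mult_left_mono[of "\<bar>Re a\<bar>" 1 v] by (simp add: t_def)
        hence t2: "(t a)\<^sup>2 \<le> v\<^sup>2" using t0 by (intro power_mono) auto
        have C: "0 \<le> C a b" "C a b \<le> 1 + v\<^sup>2"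
          using t2 circle_Re_Im(4)[OF that(2)] mult_mono[of "1 + (t a)\<^sup>2" "1 + v\<^sup>2" "\<bar>Re b\<bar>" 1] by (auto simp: C_def)
        have "S a b \<le> \<bar>(1 + (t a)\<^sup>2) * Re b\<bar> + \<bar>2 * (t a * Im b)\<bar>"
          unfolding S_def ellipse_def
          using sqrt_sum_squares_le_sum_abs[of "(1 + (t a)\<^sup>2) * Re b" "2 * (t a * Im b)"] by (simp add: power_mult_distrib)
        also have "\<bar>(1 + (t a)\<^sup>2) * Re b\<bar> = C a b" by (simp add: C_def abs_mult)
        also have "\<bar>2 * (t a * Im b)\<bar> \<le> 2 * v"
          using circle_Re_Im(5)[OF that(2)] t t0[of a] v mult_mono[of "t a" v "\<bar>Im b\<bar>" 1] by (simp add: abs_mult)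
        also have "2 * v \<le> 1 + v\<^sup>2" using sum_squares_bound[of v 1] by simp
        finally have S: "S a b \<le> B" using C by (simp add: B_def)
        have SC: "S a b + C a b \<le> 2 * B" using S C by (simp add: B_def)
        have S0: "0 \<le> S a b" by (simp add: S_def ellipse_def)
        have "ln (S a b) \<le> max 0 (ln B)" using ln_norm_le[of "of_real (S a b)" B] S S0 by simp
        moreover have "ln (S a b + C a b) \<le> max 0 (ln (2 * B))"
          using ln_norm_le[of "of_real (S a b + C a b)" "2 * B"] SC S0 C(1) unfolding norm_of_real by simp
        ultimately show ?thesis by (simp add: g_def)
      qed
      show "has_bochner_integral circle (\<lambda>b. g (a, b)) (ln 4 + (2 * ln (1 + t a) - ln 2) + 4 / pi * TI (t a))" for a
        using has_bochner_integral_add[OF has_bochner_integral_add[OF has_bochner_integral_circle_const[of "ln 4"]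
            circle_mean_ln_ellipse[of "t a"]] circle_mean_ln_ellipse_plus[of "t a"]] t0[of a]
        by (simp add: g_def S_def C_def)
      have "has_bochner_integral circle (\<lambda>a. ln 4 + (2 * ln (1 + t a) - ln 2) + 4 / pi * TI (t a))
        (ln 4 + (2 * (2 / pi * integral {0..pi / 2} (\<lambda>\<theta>. ln (1 + v * sin \<theta>))) - ln 2) + 4 / pi * (TI v - 2 / pi * TS v 1))"
        unfolding t_def
        by (intro has_bochner_integral_add has_bochner_integral_diff has_bochner_integral_circle_const
            has_bochner_integral_mult_right circle_mean_TI circle_mean_ln_one_plus_Re v)
      moreover have "ln 4 = 2 * ln (2 :: real)" using ln_realpow[of "2::real" 2] by simp
      ultimately show "has_bochner_integral circle (\<lambda>a. ln 4 + (2 * ln (1 + t a) - ln 2) + 4 / pi * TI (t a)) ?m"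
        by (simp add: algebra_simps power2_eq_square)
    qed
  qed simp
qed

theorem theorem3p2:
  fixes v :: real
  assumes "v \<ge> 0"
  shows
    "mahler (1 + X + lconst (v / 2) * (1 - X) * (Y + Z)) =
       2 / pi * integral {0..v} (\<lambda>u. arctan u / u) - 4 / pi\<^sup>2 * TS v 1 \<and>
     mahler (X + lconst (v\<^sup>2 / 4) * (1 + X)\<^sup>2 + (Y + lconst (v / 2) * (1 + X))\<^sup>2 * Z) =
       2 / pi * integral {0..v} (\<lambda>u. arctan u / u) - 4 / pi\<^sup>2 * TS v 1
       + 1 / 2 * mahler (X + lconst (v\<^sup>2 / 4) * (1 + X)\<^sup>2) \<and>
     mahler ((1 + Y) * (1 + lconst (v\<^sup>2 / 4) * (X + X_inv)\<^sup>2)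
             + lconst (v / 2) * (1 - Y) * (X + X_inv) * (Z + Z_inv)) =
       4 / pi * integral {0..v} (\<lambda>u. arctan u / u) - 8 / pi\<^sup>2 * TS v 1 \<and>
     mahler ((Z - Z_inv) + lconst (v / 2) * (X + X_inv) * (Y + Y_inv)) =
       2 / pi * integral {0..v} (\<lambda>u. arctan u / u) - 4 / pi\<^sup>2 * TS v 1 \<and>
     mahler ((4 * (1 + Y)\<^sup>2 - (Z + Z_inv)\<^sup>2) * (1 + lconst (v\<^sup>2 / 4) * (X + X_inv)\<^sup>2)\<^sup>2
             + (Z - Z_inv)\<^sup>2 * (1 + Y)\<^sup>2 * (1 - lconst (v\<^sup>2 / 4) * (X + X_inv)\<^sup>2)\<^sup>2) =
       4 / pi * integral {0..v} (\<lambda>u. arctan u / u) - 8 / pi\<^sup>2 * TS v 1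
       + 4 / pi * integral {0..pi / 2} (\<lambda>\<theta>. ln (1 + v * sin \<theta>)) + ln 2"
  using mahler_identity_1[OF assms] mahler_identity_2[OF assms] mahler_identity_3[OF assms]
    mahler_identity_4[OF assms] mahler_identity_5[OF assms]
  unfolding TI_def by blast

end
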